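(* Let $X$ be a (real or complex) Hilbert space, let $X_1,\dots,X_n$ be closed subspaces of $X$, let $m\geqslant 1$ be a natural number and let $\alpha$ be a norm on the algebraic tensor power $X^{\otimes m}$ (not necessarily the Hilbert space tensor product norm). Assume that $\alpha$ has the following property (P2): whenever $A_1:X\to X,\dots,A_m:X\to X$ are bounded linear operators, the operator $A_1\otimes\dots\otimes A_m:(X^{\otimes m})_\alpha\to(X^{\otimes m})_\alpha$ is bounded and its norm is equal to $\|A_1\|\|A_2\|\cdots\|A_m\|$. Let $E^{(m)}=(e^{(m)}_{ij})$ be the $n\times n$ matrix with $e^{(m)}_{ii}=0$ and $e^{(m)}_{ij}=(c_0(X_i,X_j))^m$ for $i\neq j$. If the spectral radius satisfies $r(E^{(m)})<1$, then the subspaces $X_1^m,\dots,X_n^m$ of $X^m$ are linearly independent and their sum is complemented in $X^m$.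
   Context: $X^{\otimes m}=X\otimes\dots\otimes X$ ($m$ copies) is the algebraic tensor product (merely a vector space), and $X_i^{\otimes m}=X_i\otimes\dots\otimes X_i$ is regarded as a subspace of it. $(X^{\otimes m})_\alpha$ is the vector space $X^{\otimes m}$ endowed with the norm $\alpha$; $X^m=X^m(\alpha)$ is its completion, and $X_i^m$ is the closure of $X_i^{\otimes m}$ in $X^m$. For closed subspaces $Y,Z$ of $X$, the cosine of the minimal angle is $$c_0(Y,Z)=\sup\{|\langle y,z\rangle|\mid y\in Y,\ \|y\|\leqslant 1,\ z\in Z,\ \|z\|\leqslant 1\},$$ where $\langle\cdot,\cdot\rangle$ is the inner product of $X$. A subspace $M$ of a Banach space $Y$ is complemented in $Y$ if there is a continuous linear projection of $Y$ onto $M$. Subspaces $Y_1,\dots,Y_n$ are linearly independent if $y_1+\dots+y_n=0$ with $y_i\in Y_i$ implies all $y_i=0$. *)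

theory Defs
  imports
    "HOL-Analysis.Analysis"
    "HOL-Library.Function_Algebras"
    "Jordan_Normal_Form.Spectral_Radius"
begin

section \<open>The scalar field: real or complex\<close>

text \<open>
  A single class covers both scalar fields, so that real and complex Hilbert spaces are treated at
  once.  Lemma \<open>rc_field_real_or_complex\<close> shows that the axioms leave no other fields.
\<close>

class rc_field = real_normed_field +
  fixes kcnj :: "'a \<Rightarrow> 'a"
  assumes kcnj_add: "kcnj (x + y) = kcnj x + kcnj y"
    and kcnj_mult: "kcnj (x * y) = kcnj x * kcnj y"
    and kcnj_scaleR_1: "kcnj (r *\<^sub>R 1) = r *\<^sub>R 1"
    and mult_kcnj_scaleR_1: "x * kcnj x = (norm x)\<^sup>2 *\<^sub>R 1"

instantiation real :: rc_field
begin
definition kcnj_real :: "real \<Rightarrow> real" where "kcnj_real x = x"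
instance by standard (simp_all add: kcnj_real_def power2_eq_square)
end

instantiation complex :: rc_field
begin
definition kcnj_complex :: "complex \<Rightarrow> complex" where "kcnj_complex z = cnj z"
instance
proof
  show "z * kcnj z = (norm z)\<^sup>2 *\<^sub>R 1" for z :: complex
    by (simp only: kcnj_complex_def scaleR_conv_of_real mult_1_right complex_norm_square)
qed (simp_all add: kcnj_complex_def)
end

lemma kcnj_of_real: "kcnj (of_real r) = (of_real r :: 'k::rc_field)"
  by (simp only: of_real_def kcnj_scaleR_1)

lemma mult_kcnj: "x * kcnj x = (of_real ((norm x)\<^sup>2) :: 'k::rc_field)"
  by (simp only: of_real_def mult_kcnj_scaleR_1)

lemma rc_field_real_or_complex:
  "(\<forall>z :: 'k::rc_field. \<exists>a. z = of_real a) \<or>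
   (\<exists>i :: 'k. i * i = - 1 \<and> kcnj i = - i \<and> (\<forall>z :: 'k. \<exists>a b. z = of_real a + of_real b * i))"
proof (cases "\<forall>z :: 'k. \<exists>a. z = of_real a")
  case False
  have tr: "\<exists>a. z + kcnj z = of_real a" for z :: 'k
  proof -
    have "(1 + z) * kcnj (1 + z) = 1 + (z + kcnj z) + z * kcnj z"
      using kcnj_of_real[of 1, where 'k = 'k] by (simp add: kcnj_add algebra_simps)
    then have "z + kcnj z = of_real ((norm (1 + z))\<^sup>2) - 1 - of_real ((norm z)\<^sup>2)"
      unfolding mult_kcnj by simp
    also have "\<dots> = of_real ((norm (1 + z))\<^sup>2 - 1 - (norm z)\<^sup>2)" by simp
    finally have "z + kcnj z = of_real ((norm (1 + z))\<^sup>2 - 1 - (norm z)\<^sup>2)" .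
    then show ?thesis by blast
  qed
  have inv: "kcnj (kcnj z) = z" for z :: 'k
  proof -
    obtain a where a: "z + kcnj z = of_real a" using tr by blast
    then have "kcnj (z + kcnj z) = z + kcnj z" by (simp only: kcnj_of_real)
    then show ?thesis by (simp add: kcnj_add add.commute)
  qed
  have zero: "kcnj 0 = (0 :: 'k)" using kcnj_of_real[of 0, where 'k = 'k] by simp
  have minus: "kcnj (- z) = - kcnj z" for z :: 'k
  proof -
    have "kcnj (z + - z) = 0" by (simp only: right_minus zero)
    then have "kcnj z + kcnj (- z) = 0" by (simp only: kcnj_add)
    then show ?thesis by (simp add: eq_neg_iff_add_eq_0 add.commute)
  qed
  have diff: "kcnj (y - z) = kcnj y - kcnj z" for y z :: 'k
    using kcnj_add[of y "- z"] by (simp add: minus)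
  have re: "\<exists>a. z = of_real a" if "kcnj z = z" for z :: 'k
  proof -
    obtain a where "z + kcnj z = of_real a" using tr by blast
    then have "2 * z = of_real a" unfolding that by simp
    then have "z = of_real (a / 2)" by (simp add: field_simps)
    then show ?thesis by blast
  qed
  from False obtain z :: 'k where z: "\<nexists>a. z = of_real a" by blast
  define w where "w = z - kcnj z"
  have "kcnj z \<noteq> z" using z re by blast
  then have w0: "w \<noteq> 0" unfolding w_def by simp
  have wc: "kcnj w = - w"
    unfolding w_def diff inv by simp
  define i where "i = of_real (1 / norm w) * w"
  have ic: "kcnj i = - i"
    unfolding i_def kcnj_mult kcnj_of_real wc by simp
  have "norm i = 1" using w0 by (simp add: i_def norm_mult norm_divide)
  then have "- (i * i) = 1" using mult_kcnj[of i] unfolding ic by simp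
  then have ii: "i * i = - 1" by (metis minus_minus)
  have "\<exists>a b. u = of_real a + of_real b * i" for u :: 'k
  proof -
    obtain a where a: "u + kcnj u = of_real a" using tr by blast
    have "kcnj ((u - kcnj u) * i) = (u - kcnj u) * i"
      unfolding kcnj_mult diff ic inv by (simp add: algebra_simps)
    then obtain b where b: "(u - kcnj u) * i = of_real b" using re by blast
    have "u - kcnj u = - ((u - kcnj u) * (i * i))" by (simp add: ii)
    also have "\<dots> = - of_real b * i" using b by (simp add: mult.assoc[symmetric])
    finally have c: "u - kcnj u = - of_real b * i" .
    have "2 * u = (u + kcnj u) + (u - kcnj u)" by simp
    then have "2 * u = of_real a - of_real b * i" unfolding a c by simp
    then have "u = of_real (a / 2) + of_real (- b / 2) * i"
      by (simp add: field_simps)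
    then show ?thesis by blast
  qed
  with ii ic show ?thesis by blast
qed simp


section \<open>Normed spaces and Hilbert spaces over the scalar field\<close>

locale normed_space = vector_space scale
  for scale :: "'k::rc_field \<Rightarrow> 'a::real_normed_vector \<Rightarrow> 'a" +
  assumes scale_of_real: "scale (of_real r) x = r *\<^sub>R x"
    and norm_scale: "norm (scale c x) = norm c * norm x"

locale hilbert_space = normed_space scale
  for scale :: "'k::rc_field \<Rightarrow> 'a::banach \<Rightarrow> 'a" +
  fixes ip :: "'a \<Rightarrow> 'a \<Rightarrow> 'k"
  assumes ip_commute: "ip y x = kcnj (ip x y)"
    and ip_add_left: "ip (x + y) z = ip x z + ip y z"
    and ip_scale_left: "ip (scale c x) y = c * ip x y"
    and ip_norm: "ip x x = of_real ((norm x)\<^sup>2)"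

definition bounded_operator ::
    "('k \<Rightarrow> 'a \<Rightarrow> 'a) \<Rightarrow> ('k \<Rightarrow> 'b \<Rightarrow> 'b) \<Rightarrow> ('a::real_normed_vector \<Rightarrow> 'b::real_normed_vector) \<Rightarrow> bool"
  where "bounded_operator s t A \<longleftrightarrow> bounded_linear A \<and> (\<forall>c x. A (s c x) = t c (A x))"

definition min_angle_cos :: "('a::real_normed_vector \<Rightarrow> 'a \<Rightarrow> 'k::real_normed_field) \<Rightarrow> 'a set \<Rightarrow> 'a set \<Rightarrow> real"
  where "min_angle_cos ip Y Z =
    Sup {norm (ip y z) |y z. y \<in> Y \<and> norm y \<le> 1 \<and> z \<in> Z \<and> norm z \<le> 1}"

definition independent_subspaces :: "nat \<Rightarrow> (nat \<Rightarrow> 'a::ab_group_add set) \<Rightarrow> bool"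
  where "independent_subspaces n Y \<longleftrightarrow>
    (\<forall>y. (\<forall>i<n. y i \<in> Y i) \<and> (\<Sum>i<n. y i) = 0 \<longrightarrow> (\<forall>i<n. y i = 0))"

definition sum_subspaces :: "nat \<Rightarrow> (nat \<Rightarrow> 'a::ab_group_add set) \<Rightarrow> 'a set"
  where "sum_subspaces n Y = {\<Sum>i<n. y i |y. \<forall>i<n. y i \<in> Y i}"

definition complemented :: "('k \<Rightarrow> 'a \<Rightarrow> 'a) \<Rightarrow> 'a::real_normed_vector set \<Rightarrow> bool"
  where "complemented s M \<longleftrightarrow>
    (\<exists>P. bounded_operator s s P \<and> (\<forall>x. P (P x) = P x) \<and> range P = M)"


section \<open>The algebraic tensor power\<close>

text \<open>
  The \<open>m\<close>-th tensor power is indexed by a finite type \<open>'m\<close> with \<open>m = CARD('m)\<close>; a tuple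
  \<open>(x\<^sub>1, \<dots>, x\<^sub>m)\<close> is a function \<open>'m \<Rightarrow> 'a\<close>.  The elementary tensor of a tuple is the evaluation
  functional \<open>f \<mapsto> f (x\<^sub>1, \<dots>, x\<^sub>m)\<close> on \<open>m\<close>-linear forms, and the algebraic tensor power is the
  linear span of the elementary tensors (the construction in Ryan, Introduction to Tensor Products
  of Banach Spaces).  Functionals are total functions, hence set to \<open>0\<close> off the multilinear forms.
  Lemma \<open>tensor_universal\<close> is the universal property.
\<close>

type_synonym ('k, 'a, 'm) tensor = "(('m \<Rightarrow> 'a) \<Rightarrow> 'k) \<Rightarrow> 'k"

definition multilinear ::
    "('k \<Rightarrow> 'a \<Rightarrow> 'a) \<Rightarrow> ('k \<Rightarrow> 'b \<Rightarrow> 'b) \<Rightarrow> (('m \<Rightarrow> 'a::ab_group_add) \<Rightarrow> 'b::ab_group_add) \<Rightarrow> bool"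
  where "multilinear s t f \<longleftrightarrow>
    (\<forall>x i y z. f (x(i := y + z)) = f (x(i := y)) + f (x(i := z))) \<and>
    (\<forall>x i c y. f (x(i := s c y)) = t c (f (x(i := y))))"

definition elem_tensor ::
    "('k \<Rightarrow> 'a \<Rightarrow> 'a) \<Rightarrow> ('m \<Rightarrow> 'a::ab_group_add) \<Rightarrow> ('k::field, 'a, 'm) tensor"
  where "elem_tensor s x = (\<lambda>f. if multilinear s (*) f then f x else 0)"

definition tensor_scale :: "'k::field \<Rightarrow> ('k, 'a, 'm) tensor \<Rightarrow> ('k, 'a, 'm) tensor"
  where "tensor_scale c u = (\<lambda>f. c * u f)"

definition tensor_power ::
    "('k \<Rightarrow> 'a \<Rightarrow> 'a) \<Rightarrow> 'a::ab_group_add set \<Rightarrow> ('k::field, 'a, 'm) tensor set"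
  where "tensor_power s Y = Modules.module.span tensor_scale {elem_tensor s x |x. \<forall>i. x i \<in> Y}"

text \<open>
  The tensor product of operators is the transpose of \<open>f \<mapsto> f \<circ> (A\<^sub>1 \<times> \<dots> \<times> A\<^sub>m)\<close>.
\<close>

definition tensor_op ::
    "('k \<Rightarrow> 'a \<Rightarrow> 'a) \<Rightarrow> ('m \<Rightarrow> 'a::ab_group_add \<Rightarrow> 'a) \<Rightarrow> ('k::field, 'a, 'm) tensor \<Rightarrow> ('k, 'a, 'm) tensor"
  where "tensor_op s A u = (\<lambda>f. if multilinear s (*) f then u (\<lambda>x. f (\<lambda>i. A i (x i))) else 0)"

interpretation tensor: vector_space "tensor_scale :: 'k::field \<Rightarrow> ('k, 'a, 'm) tensor \<Rightarrow> _"
  by standard (auto simp: tensor_scale_def fun_eq_iff algebra_simps)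

lemma tensor_op_linear:
  "tensor_op s A (u + v) = tensor_op s A u + tensor_op s A v"
  "tensor_op s A (tensor_scale c u) = tensor_scale c (tensor_op s A u)"
  by (auto simp: tensor_op_def tensor_scale_def fun_eq_iff)

lemma tensor_op_elem_tensor:
  assumes "\<And>i y z. A i (y + z) = A i y + A i z" "\<And>i c y. A i (s c y) = s c (A i y)"
  shows "tensor_op s A (elem_tensor s x) = elem_tensor s (\<lambda>i. A i (x i))"
proof -
  have "multilinear s (*) (\<lambda>x. f (\<lambda>i. A i (x i)))" if f: "multilinear s (*) f" for f
  proof -
    have "(\<lambda>j. A j ((x(i := y)) j)) = (\<lambda>j. A j (x j))(i := A i y)" for x i y
      by (auto simp: fun_eq_iff)
    with f show ?thesis unfolding multilinear_def by (simp only: assms simp_thms)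
  qed
  then show ?thesis by (auto simp: tensor_op_def elem_tensor_def fun_eq_iff)
qed

lemma elem_tensor_multilinear: "multilinear s tensor_scale (elem_tensor s)"
  by (auto simp: multilinear_def elem_tensor_def tensor_scale_def fun_eq_iff)

lemma tensor_universal:
  fixes s :: "'k::field \<Rightarrow> 'a::ab_group_add \<Rightarrow> 'a" and t :: "'k \<Rightarrow> 'b::ab_group_add \<Rightarrow> 'b"
    and g :: "('m \<Rightarrow> 'a) \<Rightarrow> 'b"
  assumes "vector_space t" and g: "multilinear s t g"
  shows "\<exists>G. Vector_Spaces.linear tensor_scale t G \<and> (\<forall>x. G (elem_tensor s x) = g x)"
proof -
  interpret T: vector_space t by fact
  interpret TT: vector_space_pair "tensor_scale :: 'k \<Rightarrow> ('k, 'a, 'm) tensor \<Rightarrow> _" t ..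
  interpret K: vector_space "(*) :: 'k \<Rightarrow> 'k \<Rightarrow> 'k"
    by standard (auto simp: algebra_simps)
  interpret TK: vector_space_pair t "(*) :: 'k \<Rightarrow> 'k \<Rightarrow> 'k" ..
  obtain B where B: "B \<subseteq> range (elem_tensor s :: ('m \<Rightarrow> 'a) \<Rightarrow> _)" "tensor.independent B"
      "range (elem_tensor s) \<subseteq> tensor.span B"
    using tensor.maximal_independent_subset by metis
  define h where "h b = g (SOME x. elem_tensor s x = b)" for b
  obtain G where G: "Vector_Spaces.linear tensor_scale t G" "\<forall>b\<in>B. G b = h b"
    using TT.linear_independent_extend[OF B(2)] by metis
  have lin: "Vector_Spaces.linear tensor_scale t G" by fact
  have "G (elem_tensor s x) = g x" for x
  proof (rule ccontr)
    assume ne: "G (elem_tensor s x) \<noteq> g x"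
    let ?v = "G (elem_tensor s x) - g x"
    have "T.independent {?v}" using ne by simp
    then obtain \<phi> where p: "Vector_Spaces.linear t (*) \<phi>" "\<phi> ?v = (1 :: 'k)"
      using TK.linear_independent_extend[of "{?v}" "\<lambda>_. 1"] by auto
    have padd: "\<phi> (a + b) = \<phi> a + \<phi> b" and psc: "\<phi> (t c a) = c * \<phi> a" for a b c
      using TK.linear_add[OF p(1)] TK.linear_scale[OF p(1)] by auto
    have ml: "multilinear s (*) (\<lambda>x. \<phi> (g x))"
      using g unfolding multilinear_def by (simp add: padd psc)
    have "\<phi> (G u) = u (\<lambda>x. \<phi> (g x))" if "u \<in> tensor.span B" for u
      using that
    proof (induction rule: tensor.span_induct_alt)
      case base
      then show ?case using TT.linear_0[OF lin] TK.linear_0[OF p(1)] by (simp add: zero_fun_def)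
    next
      case (step c b u)
      obtain y where "elem_tensor s y = b" using step(1) B(1) by blast
      then have e: "elem_tensor s (SOME y. elem_tensor s y = b) = b"
        by (rule someI[where P = "\<lambda>y. elem_tensor s y = b"])
      have "\<phi> (G b) = \<phi> (h b)" using G(2) step(1) by simp
      also have "\<dots> = elem_tensor s (SOME y. elem_tensor s y = b) (\<lambda>x. \<phi> (g x))"
        using ml by (simp add: h_def elem_tensor_def)
      also have "\<dots> = b (\<lambda>x. \<phi> (g x))" by (simp only: e)
      finally have b: "\<phi> (G b) = b (\<lambda>x. \<phi> (g x))" .
      have "\<phi> (G (tensor_scale c b + u)) = c * \<phi> (G b) + \<phi> (G u)"
        by (simp only: TT.linear_add[OF lin] TT.linear_scale[OF lin] padd psc)
      with b step(2) show ?case by (simp add: plus_fun_def tensor_scale_def)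
    qed
    then have "\<phi> (G (elem_tensor s x)) = elem_tensor s x (\<lambda>x. \<phi> (g x))" using B(3) by blast
    also have "\<dots> = \<phi> (g x)" using ml by (simp add: elem_tensor_def)
    finally show False using p TK.linear_diff[OF p(1)] by simp
  qed
  with G(1) show ?thesis by blast
qed


section \<open>Norms on the tensor power and its completion\<close>

definition norm_on ::
    "('k::real_normed_field \<Rightarrow> 'v \<Rightarrow> 'v) \<Rightarrow> 'v::ab_group_add set \<Rightarrow> ('v \<Rightarrow> real) \<Rightarrow> bool"
  where "norm_on s V N \<longleftrightarrow>
    (\<forall>u\<in>V. 0 \<le> N u) \<and> (\<forall>u\<in>V. N u = 0 \<longleftrightarrow> u = 0) \<and>
    (\<forall>u\<in>V. \<forall>v\<in>V. N (u + v) \<le> N u + N v) \<and>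
    (\<forall>c. \<forall>u\<in>V. N (s c u) = norm c * N u)"

text \<open>
  \<open>operator_norm_on V N S\<close> is \<^const>\<open>onorm\<close> for the norm \<open>N\<close> on the carrier \<open>V\<close>; as there,
  the quotient at \<open>u = 0\<close> is \<open>0\<close>.
\<close>

definition bounded_on :: "'v set \<Rightarrow> ('v \<Rightarrow> real) \<Rightarrow> ('v \<Rightarrow> 'v) \<Rightarrow> bool"
  where "bounded_on V N S \<longleftrightarrow> (\<exists>C. \<forall>u\<in>V. N (S u) \<le> C * N u)"

definition operator_norm_on :: "'v set \<Rightarrow> ('v \<Rightarrow> real) \<Rightarrow> ('v \<Rightarrow> 'v) \<Rightarrow> real"
  where "operator_norm_on V N S = (SUP u\<in>V. N (S u) / N u)"

definition property_P2 ::
    "('k \<Rightarrow> 'a \<Rightarrow> 'a) \<Rightarrow> (('k::field, 'a::real_normed_vector, 'm::finite) tensor \<Rightarrow> real) \<Rightarrow> bool"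
  where "property_P2 s \<alpha> \<longleftrightarrow>
    (\<forall>A :: 'm \<Rightarrow> 'a \<Rightarrow> 'a. (\<forall>i. bounded_operator s s (A i)) \<longrightarrow>
      bounded_on (tensor_power s UNIV) \<alpha> (tensor_op s A) \<and>
      operator_norm_on (tensor_power s UNIV) \<alpha> (tensor_op s A) = (\<Prod>i\<in>UNIV. onorm (A i)))"

text \<open>
  A completion of \<open>(V, N)\<close> is a Banach space together with a linear isometry \<open>\<iota>\<close> of \<open>V\<close> onto
  a dense subspace; it is unique up to an isometric isomorphism fixing \<open>V\<close>.
\<close>

definition completion_of ::
    "('k::rc_field \<Rightarrow> 'v \<Rightarrow> 'v) \<Rightarrow> 'v::ab_group_add set \<Rightarrow> ('v \<Rightarrow> real) \<Rightarrow>
     ('k \<Rightarrow> 'c \<Rightarrow> 'c) \<Rightarrow> ('v \<Rightarrow> 'c::banach) \<Rightarrow> bool"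
  where "completion_of s V N t \<iota> \<longleftrightarrow>
    normed_space t \<and>
    (\<forall>u\<in>V. \<forall>v\<in>V. \<iota> (u + v) = \<iota> u + \<iota> v) \<and>
    (\<forall>c. \<forall>u\<in>V. \<iota> (s c u) = t c (\<iota> u)) \<and>
    (\<forall>u\<in>V. norm (\<iota> u) = N u) \<and>
    closure (\<iota> ` V) = UNIV"

definition closed_tensor_power ::
    "('k \<Rightarrow> 'a \<Rightarrow> 'a) \<Rightarrow> (('k::field, 'a::ab_group_add, 'm) tensor \<Rightarrow> 'c::topological_space) \<Rightarrow> 'a set \<Rightarrow> 'c set"
  where "closed_tensor_power s \<iota> Y = closure (\<iota> ` tensor_power s Y)"

definition angle_matrix ::
    "('a::real_normed_vector \<Rightarrow> 'a \<Rightarrow> 'k::real_normed_field) \<Rightarrow> nat \<Rightarrow> nat \<Rightarrow> (nat \<Rightarrow> 'a set) \<Rightarrow> complex mat"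
  where "angle_matrix ip m n X =
    mat n n (\<lambda>(i, j). if i = j then 0 else complex_of_real (min_angle_cos ip (X i) (X j) ^ m))"

end

theory Submission
  imports Defs
begin

text \<open>
  Let \<open>P\<^sub>i\<close> be the orthogonal projection of \<open>X\<close> onto \<open>X\<^sub>i\<close>.  Property (P2) makes the \<open>m\<close>-fold tensor power of
  \<open>P\<^sub>i\<close> bounded, so it extends to a bounded projection \<open>Q\<^sub>i\<close> of the completion, and the range of \<open>Q\<^sub>i\<close> is the
  closure of the tensor power of \<open>X\<^sub>i\<close> (\<open>tensor_projection\<close>).  On tensors over \<open>X\<^sub>j\<close> the operators \<open>P\<^sub>i\<close> and
  \<open>P\<^sub>i P\<^sub>j\<close> agree; since \<open>\<parallel>P\<^sub>i P\<^sub>j\<parallel> \<le> c\<^sub>0(X\<^sub>i, X\<^sub>j)\<close>, property (P2) gives \<open>\<parallel>Q\<^sub>i y\<parallel> \<le> c\<^sub>0(X\<^sub>i, X\<^sub>j)\<^sup>m \<parallel>y\<parallel>\<close> for \<open>y\<close> in the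
  range of \<open>Q\<^sub>j\<close> (\<open>norm_tensor_projection_le\<close>).  So the theorem follows from a statement about projections
  in a Banach space whose mutual interaction is dominated by a nonnegative matrix of spectral radius
  less than \<open>1\<close>.

  For such a matrix there are weights \<open>w\<^sub>i \<ge> 1\<close> and \<open>q < 1\<close> with \<open>(\<Sum>j. e\<^sub>i\<^sub>j w\<^sub>j) \<le> q w\<^sub>i\<close>
  (\<open>subinvariant_weight_exists\<close>).  In the norm \<open>max\<^sub>i \<parallel>y\<^sub>i\<parallel> / w\<^sub>i\<close> the map sending a tuple \<open>y\<close> of vectors of the
  ranges to \<open>(\<Sum>j\<noteq>i. Q\<^sub>i y\<^sub>j)\<^sub>i\<close> is therefore a contraction.  Applying \<open>Q\<^sub>i\<close> to \<open>x = y\<^sub>1 + \<dots> + y\<^sub>n\<close> gives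
  \<open>y\<^sub>i + (\<Sum>j\<noteq>i. Q\<^sub>i y\<^sub>j) = Q\<^sub>i x\<close>, a system with exactly one solution.  Uniqueness with \<open>x = 0\<close> is the linear
  independence of the ranges; the Neumann series solves the system for every \<open>x\<close>, linearly and
  boundedly, and the sum of the entries of the solution is the required projection
  (\<open>complemented_sum\<close>).
\<close>


section \<open>Orthogonal projections and the minimal angle\<close>

context hilbert_space
begin

lemma scaleR_subspace:
  assumes "subspace Y" "y \<in> Y"
  shows "r *\<^sub>R y \<in> Y"
  using subspace_scale[OF assms, of "of_real r"] by (simp add: scale_of_real)

lemma kcnj_kcnj_ip: "kcnj (kcnj (ip x y)) = ip x y"
  by (metis ip_commute)

lemma ip_zero_left [simp]: "ip 0 y = 0"
  using ip_add_left[of 0 0 y] by simp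

lemma kcnj_zero [simp]: "kcnj 0 = (0::'k)"
  using kcnj_of_real[of 0, where 'k='k] by simp

lemma ip_zero_right [simp]: "ip y 0 = 0"
  by (metis ip_commute ip_zero_left kcnj_zero)

lemma ip_minus_left: "ip (- x) y = - ip x y"
  using ip_add_left[of x "- x" y] by (simp add: eq_neg_iff_add_eq_0 add.commute)

lemma ip_diff_left: "ip (x - y) z = ip x z - ip y z"
  using ip_add_left[of x "- y" z] by (simp add: ip_minus_left)

lemma ip_add_right: "ip z (x + y) = ip z x + ip z y"
  by (metis ip_commute ip_add_left kcnj_add)

lemma ip_minus_right: "ip z (- y) = - ip z y"
  using ip_add_right[of z y "- y"] by (simp add: eq_neg_iff_add_eq_0 add.commute)

lemma ip_diff_right: "ip z (x - y) = ip z x - ip z y"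
  using ip_add_right[of z x "- y"] by (simp add: ip_minus_right)

lemma ip_scale_right: "ip x (scale c y) = kcnj c * ip x y"
  by (metis ip_commute ip_scale_left kcnj_mult)

lemma ip_self_eq_0: "ip x x = 0 \<longleftrightarrow> x = 0"
  by (simp add: ip_norm)

lemma parallelogram: "(norm (x + y :: 'a))\<^sup>2 + (norm (x - y))\<^sup>2 = 2 * (norm x)\<^sup>2 + 2 * (norm y)\<^sup>2"
proof -
  have "ip (x + y) (x + y) + ip (x - y) (x - y) = 2 * ip x x + 2 * ip y y"
    by (simp add: ip_add_left ip_add_right ip_diff_left ip_diff_right)
  then have "of_real ((norm (x + y))\<^sup>2 + (norm (x - y))\<^sup>2)
      = (of_real (2 * (norm x)\<^sup>2 + 2 * (norm y)\<^sup>2) :: 'k)"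
    by (simp only: ip_norm of_real_add of_real_mult of_real_numeral)
  then show ?thesis by (simp only: of_real_eq_iff)
qed

text \<open>
  Subtracting from \<open>z\<close> its component along \<open>y\<close> shortens it by an explicit amount.  Since squared norms
  are nonnegative this gives the Cauchy--Schwarz inequality; at a nearest point nothing can be
  gained, which gives orthogonality.
\<close>

lemma norm_diff_component:
  assumes "y \<noteq> 0"
  shows "(norm (z - scale (of_real (1 / (norm y)\<^sup>2) * ip z y) y))\<^sup>2
    = (norm z)\<^sup>2 - (norm (ip z y) / norm y)\<^sup>2"
proof -
  let ?r = "1 / (norm y)\<^sup>2"
  let ?c = "of_real ?r * ip z y"
  have sq: "ip z y * kcnj (ip z y) = of_real ((norm (ip z y))\<^sup>2)"
    by (rule mult_kcnj)
  have one: "of_real ?r * ip y y = (1 :: 'k)"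
    unfolding ip_norm of_real_mult[symmetric] using assms by simp
  have c: "kcnj ?c = of_real ?r * kcnj (ip z y)"
    by (simp only: kcnj_mult kcnj_of_real)
  have "ip (z - scale ?c y) (z - scale ?c y)
      = ip z z - ?c * ip y z - kcnj ?c * ip z y + ?c * (kcnj ?c * ip y y)"
    by (simp add: ip_diff_left ip_diff_right ip_scale_left ip_scale_right algebra_simps)
  also have "\<dots> = ip z z - of_real ?r * (ip z y * kcnj (ip z y))
      - of_real ?r * (ip z y * kcnj (ip z y))
      + of_real ?r * (ip z y * kcnj (ip z y)) * (of_real ?r * ip y y)"
    unfolding c ip_commute[of y z] by (simp only: mult_ac)
  also have "\<dots> = ip z z - of_real ?r * (ip z y * kcnj (ip z y))"
    unfolding one by simp
  also have "\<dots> = of_real ((norm z)\<^sup>2 - (norm (ip z y) / norm y)\<^sup>2)"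
    unfolding sq ip_norm of_real_mult[symmetric] of_real_diff[symmetric] power_divide by simp
  finally show ?thesis unfolding ip_norm of_real_eq_iff .
qed

lemma Cauchy_Schwarz: "norm (ip x y) \<le> norm x * norm y"
proof (cases "y = 0")
  case False
  have "0 \<le> (norm x)\<^sup>2 - (norm (ip x y) / norm y)\<^sup>2"
    using norm_diff_component[OF False, of x] by (metis zero_le_power2)
  then have "(norm (ip x y) / norm y)\<^sup>2 \<le> (norm x)\<^sup>2" by linarith
  then have "norm (ip x y) / norm y \<le> norm x" by (rule power2_le_imp_le) simp
  with False show ?thesis by (simp add: divide_le_eq)
qed simp

text \<open>By the parallelogram law, a minimising sequence is Cauchy.\<close>

lemma nearest_point_exists:
  assumes "subspace Y" "closed Y"
  shows "\<exists>p\<in>Y. \<forall>y\<in>Y. norm (x - p) \<le> norm (x - y)"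
proof -
  have ne: "Y \<noteq> {}" using subspace_0[OF assms(1)] by blast
  define d where "d = infdist x Y"
  have d0: "0 \<le> d" by (simp add: d_def infdist_nonneg)
  have le: "d \<le> norm (x - y)" if "y \<in> Y" for y
    using infdist_le[OF that, of x] by (simp add: d_def dist_norm)
  have "\<exists>y\<in>Y. (norm (x - y))\<^sup>2 < d\<^sup>2 + inverse (Suc k)" for k
  proof -
    have "d < sqrt (d\<^sup>2 + inverse (Suc k))"
      using d0 by (intro real_less_rsqrt) simp
    then have "Inf ((\<lambda>y. dist x y) ` Y) < sqrt (d\<^sup>2 + inverse (Suc k))"
      using ne by (simp add: d_def infdist_def)
    then obtain y where y: "y \<in> Y" "dist x y < sqrt (d\<^sup>2 + inverse (Suc k))"
      by (metis (no_types, lifting) cInf_lessD imageE image_is_empty ne)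
    then have "(dist x y)\<^sup>2 < (sqrt (d\<^sup>2 + inverse (Suc k)))\<^sup>2"
      by (intro power_strict_mono) auto
    also have "\<dots> = d\<^sup>2 + inverse (Suc k)" by (simp del: of_nat_Suc)
    finally show ?thesis using y(1) by (auto simp: dist_norm)
  qed
  then obtain f where f: "\<And>k. f k \<in> Y" "\<And>k. (norm (x - f k))\<^sup>2 < d\<^sup>2 + inverse (Suc k)"
    by metis
  \<comment> \<open>the midpoint of two members of the sequence is no nearer than \<open>d\<close>\<close>
  have close: "(norm (f k - f l))\<^sup>2 \<le> 2 * inverse (Suc k) + 2 * inverse (Suc l)" for k l
  proof -
    let ?m = "(1/2) *\<^sub>R (f k + f l)"
    have "?m \<in> Y"
      by (intro scaleR_subspace[OF assms(1)] subspace_add[OF assms(1)] f(1))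
    then have "d\<^sup>2 \<le> (norm (x - ?m))\<^sup>2" using le d0 by (intro power_mono) auto
    moreover have "(x - f k) + (x - f l) = 2 *\<^sub>R (x - ?m)"
      by (simp add: algebra_simps scaleR_2)
    then have "(norm ((x - f k) + (x - f l)))\<^sup>2 = 4 * (norm (x - ?m))\<^sup>2"
      by (simp only: norm_scaleR) (simp add: power_mult_distrib)
    moreover have "(x - f k) - (x - f l) = - (f k - f l)" by simp
    then have "(norm ((x - f k) - (x - f l)))\<^sup>2 = (norm (f k - f l))\<^sup>2"
      by (simp only: norm_minus_cancel)
    ultimately show ?thesis
      using parallelogram[of "x - f k" "x - f l"] f(2)[of k] f(2)[of l] by linarith
  qed
  have "Cauchy f"
  proof (rule metric_CauchyI)
    fix e :: real assume e: "0 < e"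
    then have "0 < e\<^sup>2 / 4" by simp
    then obtain N where N: "inverse (real (Suc N)) < e\<^sup>2 / 4" using reals_Archimedean by blast
    have "dist (f k) (f l) < e" if "N \<le> k" "N \<le> l" for k l
    proof -
      have "inverse (real (Suc k)) \<le> inverse (real (Suc N))"
           "inverse (real (Suc l)) \<le> inverse (real (Suc N))"
        using that by (auto intro!: le_imp_inverse_le)
      then have "2 * inverse (real (Suc k)) + 2 * inverse (real (Suc l)) \<le> 4 * inverse (real (Suc N))"
        by linarith
      also have "\<dots> < e\<^sup>2" using N by simp
      finally have "(norm (f k - f l))\<^sup>2 < e\<^sup>2" by (rule order.strict_trans1[OF close])
      then show ?thesis unfolding dist_norm by (rule power2_less_imp_less) (use e in simp)
    qed
    then show "\<exists>N. \<forall>k\<ge>N. \<forall>l\<ge>N. dist (f k) (f l) < e" by blast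
  qed
  then obtain p where p: "f \<longlonglongrightarrow> p" by (auto simp: Cauchy_convergent_iff convergent_def)
  have pY: "p \<in> Y" using closed_sequentially[OF assms(2) _ p] f(1) by blast
  have "(\<lambda>k. (norm (x - f k))\<^sup>2) \<longlonglongrightarrow> (norm (x - p))\<^sup>2"
    by (intro tendsto_intros p)
  moreover have "(\<lambda>k. d\<^sup>2 + inverse (real (Suc k))) \<longlonglongrightarrow> d\<^sup>2 + 0"
    by (intro tendsto_intros LIMSEQ_inverse_real_of_nat)
  ultimately have "(norm (x - p))\<^sup>2 \<le> d\<^sup>2 + 0"
    by (rule LIMSEQ_le) (use f(2) less_imp_le in blast)
  then have "(norm (x - p))\<^sup>2 \<le> d\<^sup>2" by simp
  then have "norm (x - p) \<le> d" by (rule power2_le_imp_le[OF _ d0])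
  then show ?thesis using pY le order_trans by blast
qed

lemma nearest_point_orthogonal:
  assumes "subspace Y" "p \<in> Y" "\<And>y. y \<in> Y \<Longrightarrow> norm (x - p) \<le> norm (x - y)" "y \<in> Y"
  shows "ip (x - p) y = 0"
proof (cases "y = 0")
  case False
  let ?z = "x - p"
  let ?c = "of_real (1 / (norm y)\<^sup>2) * ip ?z y"
  have "p + scale ?c y \<in> Y"
    by (intro subspace_add[OF assms(1)] subspace_scale[OF assms(1)] assms(2,4))
  then have "norm ?z \<le> norm (?z - scale ?c y)"
    using assms(3) by (metis diff_diff_eq)
  then have "(norm ?z)\<^sup>2 \<le> (norm (?z - scale ?c y))\<^sup>2"
    by (intro power_mono) auto
  then have "(norm (ip ?z y) / norm y)\<^sup>2 \<le> 0"
    unfolding norm_diff_component[OF False] by linarith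
  then show ?thesis using False by simp
qed simp

lemma orthogonal_projection_exists:
  assumes Y: "subspace Y" "closed Y"
  obtains P where "bounded_operator scale scale P" "\<And>x. P x \<in> Y" "\<And>y. y \<in> Y \<Longrightarrow> P y = y"
    "\<And>x y. y \<in> Y \<Longrightarrow> ip (x - P x) y = 0" "\<And>x. norm (P x) \<le> norm x"
proof -
  have "\<exists>p\<in>Y. \<forall>y\<in>Y. ip (x - p) y = 0" for x
    using nearest_point_exists[OF Y, of x] nearest_point_orthogonal[OF Y(1)] by metis
  then obtain P where P: "\<And>x. P x \<in> Y" "\<And>x y. y \<in> Y \<Longrightarrow> ip (x - P x) y = 0"
    by metis
  have unique: "P x = p" if "p \<in> Y" "\<And>y. y \<in> Y \<Longrightarrow> ip (x - p) y = 0" for x p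
  proof -
    let ?y = "P x - p"
    have "?y \<in> Y" by (intro subspace_diff[OF Y(1)] P(1) that(1))
    then have "ip (x - p) ?y - ip (x - P x) ?y = 0" using P(2) that(2) by simp
    then have "ip ?y ?y = 0" by (simp add: ip_diff_left[symmetric])
    then show ?thesis by (simp add: ip_self_eq_0)
  qed
  have add: "P (x + y) = P x + P y" for x y
  proof (rule unique)
    show "P x + P y \<in> Y" by (intro subspace_add[OF Y(1)] P(1))
    show "ip (x + y - (P x + P y)) z = 0" if "z \<in> Y" for z
      using P(2)[OF that] by (simp add: ip_add_left ip_diff_left)
  qed
  have scale: "P (scale c x) = scale c (P x)" for c x
  proof (rule unique)
    show "scale c (P x) \<in> Y" by (intro subspace_scale[OF Y(1)] P(1))
    show "ip (scale c x - scale c (P x)) z = 0" if "z \<in> Y" for z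
      using P(2)[OF that] by (simp add: ip_scale_left scale_right_diff_distrib[symmetric])
  qed
  have contraction: "norm (P x) \<le> norm x" for x
  proof -
    have "ip (P x) (P x) = ip x (P x)" using P(2)[OF P(1), of x x] by (simp add: ip_diff_left)
    then have "(of_real ((norm (P x))\<^sup>2) :: 'k) = ip x (P x)" by (simp only: ip_norm)
    then have "(norm (P x))\<^sup>2 = norm (ip x (P x))"
      by (metis norm_of_real abs_of_nonneg zero_le_power2)
    also have "\<dots> \<le> norm x * norm (P x)" by (rule Cauchy_Schwarz)
    finally show ?thesis by (cases "P x = 0") (auto simp: power2_eq_square)
  qed
  have "bounded_linear P"
  proof (rule bounded_linear_intro)
    show "P (r *\<^sub>R x) = r *\<^sub>R P x" for r x
      using scale[of "of_real r" x] by (simp add: scale_of_real)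
    show "norm (P x) \<le> norm x * 1" for x using contraction by simp
  qed (rule add)
  then have "bounded_operator scale scale P" using scale by (simp add: bounded_operator_def)
  moreover have "P y = y" if "y \<in> Y" for y by (rule unique[OF that]) simp
  ultimately show thesis using that[of P] P contraction by blast
qed

lemma bdd_above_ip_unit:
  "bdd_above {norm (ip y z) |y z. y \<in> Y \<and> norm y \<le> 1 \<and> z \<in> Z \<and> norm z \<le> 1}"
  (is "bdd_above ?S")
proof (rule bdd_aboveI)
  fix s assume "s \<in> ?S"
  then obtain a b where "s = norm (ip a b)" "norm a \<le> 1" "norm b \<le> 1" by blast
  then show "s \<le> 1"
    using order_trans[OF Cauchy_Schwarz mult_le_one[OF _ norm_ge_zero]] by blast
qed

lemma norm_ip_le_min_angle_cos:
  assumes "subspace Y" "subspace Z" "y \<in> Y" "z \<in> Z"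
  shows "norm (ip y z) \<le> min_angle_cos ip Y Z * norm y * norm z"
proof (cases "y = 0 \<or> z = 0")
  case False
  let ?S = "{norm (ip y z) |y z. y \<in> Y \<and> norm y \<le> 1 \<and> z \<in> Z \<and> norm z \<le> 1}"
  let ?y = "scale (of_real (1 / norm y)) y" and ?z = "scale (of_real (1 / norm z)) z"
  have "norm (ip ?y ?z) \<in> ?S"
    using False assms by (auto simp: norm_scale norm_divide intro!: subspace_scale exI)
  then have "norm (ip ?y ?z) \<le> min_angle_cos ip Y Z"
    unfolding min_angle_cos_def using bdd_above_ip_unit by (rule cSup_upper)
  moreover have "norm (ip ?y ?z) = norm (ip y z) / (norm y * norm z)"
    unfolding ip_scale_left ip_scale_right kcnj_of_real norm_mult norm_of_real by simp
  ultimately show ?thesis using False by (simp add: divide_le_eq mult.assoc)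
qed auto

lemma min_angle_cos_nonneg:
  assumes "subspace Y" "subspace Z"
  shows "0 \<le> min_angle_cos ip Y Z"
proof -
  let ?S = "{norm (ip y z) |y z. y \<in> Y \<and> norm y \<le> 1 \<and> z \<in> Z \<and> norm z \<le> 1}"
  have "norm (ip 0 0) \<in> ?S"
    using subspace_0[OF assms(1)] subspace_0[OF assms(2)] by fastforce
  then show ?thesis unfolding min_angle_cos_def
    using cSup_upper[OF _ bdd_above_ip_unit] by force
qed

text \<open>
  For \<open>a = P (Q x)\<close> orthogonality gives \<open>\<parallel>a\<parallel>\<^sup>2 = \<langle>a, Q x\<rangle>\<close>, a product of a vector of \<open>Y\<close> with one of \<open>Z\<close>.
\<close>

lemma onorm_comp_projections_le_min_angle_cos:
  assumes "subspace Y" "subspace Z"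
    and P: "\<And>x. P x \<in> Y" "\<And>x y. y \<in> Y \<Longrightarrow> ip (x - P x) y = 0"
    and Q: "\<And>x. Q x \<in> Z" "\<And>x. norm (Q x) \<le> norm x"
  shows "onorm (P \<circ> Q) \<le> min_angle_cos ip Y Z"
proof (rule onorm_bound[OF min_angle_cos_nonneg[OF assms(1,2)]])
  fix x
  let ?a = "P (Q x)"
  have "ip ?a ?a = ip (Q x) ?a" using P(2)[OF P(1), of "Q x" "Q x"] by (simp add: ip_diff_left)
  then have "(of_real ((norm ?a)\<^sup>2) :: 'k) = kcnj (ip ?a (Q x))"
    by (simp only: ip_norm ip_commute[of "Q x" ?a])
  then have "(of_real ((norm ?a)\<^sup>2) :: 'k) = ip ?a (Q x)"
    by (metis kcnj_kcnj_ip kcnj_of_real)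
  then have "(norm ?a)\<^sup>2 = norm (ip ?a (Q x))"
    by (metis norm_of_real abs_of_nonneg zero_le_power2)
  also have "\<dots> \<le> min_angle_cos ip Y Z * norm ?a * norm (Q x)"
    by (rule norm_ip_le_min_angle_cos[OF assms(1,2) P(1) Q(1)])
  also have "\<dots> \<le> min_angle_cos ip Y Z * norm ?a * norm x"
    by (intro mult_left_mono Q(2) mult_nonneg_nonneg min_angle_cos_nonneg assms(1,2)) simp
  finally have "norm ?a * norm ?a \<le> norm ?a * (min_angle_cos ip Y Z * norm x)"
    by (simp add: power2_eq_square mult_ac)
  then show "norm ((P \<circ> Q) x) \<le> min_angle_cos ip Y Z * norm x"
    using min_angle_cos_nonneg[OF assms(1,2)] by (cases "?a = 0") auto
qed

end

section \<open>Nonnegative matrices of spectral radius less than one\<close>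

definition mat_apply :: "nat \<Rightarrow> (nat \<Rightarrow> nat \<Rightarrow> real) \<Rightarrow> (nat \<Rightarrow> real) \<Rightarrow> nat \<Rightarrow> real"
  where "mat_apply n a x i = (\<Sum>j<n. a i j * x j)"

abbreviation complex_mat :: "nat \<Rightarrow> (nat \<Rightarrow> nat \<Rightarrow> real) \<Rightarrow> complex mat"
  where "complex_mat n a \<equiv> mat n n (\<lambda>(i, j). complex_of_real (a i j))"

lemma complex_mat_pow_mult_vec:
  "complex_mat n a ^\<^sub>m k *\<^sub>v Matrix.vec n (\<lambda>i. complex_of_real (x i))
    = Matrix.vec n (\<lambda>i. complex_of_real ((mat_apply n a ^^ k) x i))"
proof (induction k arbitrary: x)
  case 0
  then show ?case by (simp add: one_mult_mat_vec[where n = n])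
next
  case (Suc k)
  let ?A = "complex_mat n a" and ?x = "Matrix.vec n (\<lambda>i. complex_of_real (x i))"
  have A: "?A \<in> carrier_mat n n" and x: "?x \<in> carrier_vec n" by simp_all
  have "?A *\<^sub>v ?x = Matrix.vec n (\<lambda>i. complex_of_real (mat_apply n a x i))"
    by (rule eq_vecI)
      (auto simp: mat_apply_def scalar_prod_def atLeast0LessThan)
  then have "?A ^\<^sub>m k *\<^sub>v (?A *\<^sub>v ?x) = Matrix.vec n (\<lambda>i. complex_of_real ((mat_apply n a ^^ k) (mat_apply n a x) i))"
    by (simp only: Suc.IH)
  moreover have "?A ^\<^sub>m Suc k *\<^sub>v ?x = ?A ^\<^sub>m k *\<^sub>v (?A *\<^sub>v ?x)"
    using assoc_mult_mat_vec[OF pow_carrier_mat[OF A] A x] by simp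
  ultimately show ?case by (simp only: funpow_Suc_right o_apply)
qed

text \<open>
  The Jordan normal form bounds the powers of a complex matrix of spectral radius below \<open>1\<close>; row
  sums of powers are the iterates on the constant vector \<open>1\<close>.
\<close>

lemma mat_apply_pow_bounded:
  assumes "spectral_radius (complex_mat n a) < 1"
  shows "\<exists>C. \<forall>k. \<forall>i<n. \<bar>(mat_apply n a ^^ k) (\<lambda>_. 1) i\<bar> \<le> C"
proof -
  let ?A = "complex_mat n a"
  let ?one = "Matrix.vec n (\<lambda>i. complex_of_real 1)"
  have A: "?A \<in> carrier_mat n n" by simp
  obtain c where c: "\<And>k. norm_bound (?A ^\<^sub>m k) c"
    using spectral_radius_jnf_norm_bound_less_1_upper_triangular[OF A assms] by blast
  have "\<bar>(mat_apply n a ^^ k) (\<lambda>_. 1) i\<bar> \<le> real n * c" if i: "i < n" for k i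
  proof -
    have Ak: "?A ^\<^sub>m k \<in> carrier_mat n n" by (rule pow_carrier_mat[OF A])
    then have dims: "dim_row (?A ^\<^sub>m k) = n" "dim_col (?A ^\<^sub>m k) = n" by auto
    have "complex_of_real ((mat_apply n a ^^ k) (\<lambda>_. 1) i) = vec_index (?A ^\<^sub>m k *\<^sub>v ?one) i"
      unfolding complex_mat_pow_mult_vec using i by simp
    also have "\<dots> = (\<Sum>j<n. (?A ^\<^sub>m k) $$ (i, j))"
      using i dims by (simp add: scalar_prod_def atLeast0LessThan)
    finally have "\<bar>(mat_apply n a ^^ k) (\<lambda>_. 1) i\<bar> = norm (\<Sum>j<n. (?A ^\<^sub>m k) $$ (i, j))"
      by (metis norm_of_real real_norm_def)
    also have "\<dots> \<le> (\<Sum>j<n. norm ((?A ^\<^sub>m k) $$ (i, j)))" by (rule norm_sum)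
    also have "\<dots> \<le> (\<Sum>j<n. c)"
      using c[of k] i dims by (intro sum_mono) (auto simp: norm_bound_def)
    finally show ?thesis by simp
  qed
  then show ?thesis by blast
qed

text \<open>
  Dividing by a number \<open>t < 1\<close> above the spectral radius leaves room for a factor \<open>t ^ k\<close>: bounded
  powers of the scaled matrix are geometric decay for the original one.
\<close>

lemma spectral_radius_scaled_less_1:
  assumes "n > 0" and sr: "spectral_radius (complex_mat n a) < t" and "t > 0"
  shows "spectral_radius (complex_mat n (\<lambda>i j. a i j / t)) < 1"
proof -
  let ?A = "complex_mat n a" and ?B = "complex_mat n (\<lambda>i j. a i j / t)"
  have A: "?A \<in> carrier_mat n n" and B: "?B \<in> carrier_mat n n" by simp_all
  obtain \<mu> where \<mu>: "spectral_radius ?B = norm \<mu>" "\<mu> \<in> spectrum ?B"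
    using spectral_radius_mem_max(1)[OF B assms(1)] by blast
  then obtain v where v: "v \<in> carrier_vec n" "v \<noteq> 0\<^sub>v n" "?B *\<^sub>v v = \<mu> \<cdot>\<^sub>v v"
    by (auto simp: spectrum_def eigenvalue_def eigenvector_def)
  have AB: "?A = complex_of_real t \<cdot>\<^sub>m ?B"
    by (rule eq_matI) (use assms(3) in auto)
  have "?A *\<^sub>v v = complex_of_real t \<cdot>\<^sub>v (?B *\<^sub>v v)"
    unfolding AB using v(1)
    by (intro eq_vecI) (auto simp: scalar_prod_def sum_distrib_left mult.assoc intro!: sum.cong)
  also have "\<dots> = (complex_of_real t * \<mu>) \<cdot>\<^sub>v v" by (simp only: v(3) smult_smult_assoc)
  finally have "complex_of_real t * \<mu> \<in> spectrum ?A"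
    using v(1,2) by (auto simp: spectrum_def eigenvalue_def eigenvector_def)
  then have "norm (complex_of_real t * \<mu>) \<le> spectral_radius ?A"
    using spectral_radius_mem_max(2)[OF A assms(1)] by blast
  then have "t * norm \<mu> \<le> spectral_radius ?A" using assms(3) by (simp add: norm_mult)
  then have "t * norm \<mu> < t * 1" using sr by linarith
  then show ?thesis using assms(3) \<mu>(1) by simp
qed

lemma mat_apply_divide:
  assumes "t \<noteq> 0"
  shows "(mat_apply n a ^^ k) x i = t ^ k * (mat_apply n (\<lambda>i j. a i j / t) ^^ k) x i"
  using assms
  by (induction k arbitrary: i) (auto simp: mat_apply_def sum_distrib_left intro!: sum.cong)

text \<open>
  The weight is a partial sum \<open>w = 1 + a 1 + \<dots> + a\<^sup>K 1\<close> of the Neumann series.  Then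
  \<open>a w = w - 1 + a\<^bsup>K+1\<^esup> 1\<close>, and by geometric decay the last term is at most \<open>1/2\<close> for large \<open>K\<close>.  The
  gain of \<open>1/2\<close> in each coordinate is a factor below \<open>1\<close> because \<open>w\<close> is bounded.
\<close>

lemma subinvariant_weight_exists:
  fixes a :: "nat \<Rightarrow> nat \<Rightarrow> real"
  assumes n: "n > 0" and nonneg: "\<And>i j. i < n \<Longrightarrow> j < n \<Longrightarrow> 0 \<le> a i j"
    and sr: "spectral_radius (complex_mat n a) < 1"
  shows "\<exists>q w. 0 \<le> q \<and> q < 1 \<and> (\<forall>i<n. 1 \<le> w i \<and> (\<Sum>j<n. a i j * w j) \<le> q * w i)"
proof -
  have A: "complex_mat n a \<in> carrier_mat n n" by simp
  define t where "t = (1 + spectral_radius (complex_mat n a)) / 2"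
  have "0 \<le> spectral_radius (complex_mat n a)"
    using spectral_radius_mem_max(1)[OF A n] by auto
  then have t: "0 < t" "t < 1" "spectral_radius (complex_mat n a) < t"
    using sr by (auto simp: t_def)
  define v where "v k = (mat_apply n a ^^ k) (\<lambda>_. 1)" for k
  obtain C where C: "\<And>k i. i < n \<Longrightarrow> \<bar>(mat_apply n (\<lambda>i j. a i j / t) ^^ k) (\<lambda>_. 1) i\<bar> \<le> C"
    using mat_apply_pow_bounded[OF spectral_radius_scaled_less_1[OF n t(3,1)]] by blast
  have v_le: "v k i \<le> t ^ k * C" if "i < n" for k i
  proof -
    have "v k i = t ^ k * (mat_apply n (\<lambda>i j. a i j / t) ^^ k) (\<lambda>_. 1) i"
      unfolding v_def using t(1) by (intro mat_apply_divide) simp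
    also have "\<dots> \<le> t ^ k * C"
      using C[OF that, of k] t(1) by (intro mult_left_mono) auto
    finally show ?thesis .
  qed
  have v_nonneg: "0 \<le> v k i" if "i < n" for k i
    using that unfolding v_def
    by (induction k arbitrary: i) (auto simp: mat_apply_def intro!: sum_nonneg mult_nonneg_nonneg nonneg)
  have "(\<lambda>k. t ^ k * C) \<longlonglongrightarrow> 0 * C"
    using t by (intro tendsto_intros LIMSEQ_power_zero) auto
  then have "\<forall>\<^sub>F k in sequentially. t ^ k * C < 1 / 2" by (intro order_tendstoD) auto
  then obtain K where "\<forall>k\<ge>K. t ^ k * C < 1 / 2" by (auto simp: eventually_sequentially)
  then have K: "t ^ Suc K * C < 1 / 2" by (meson le_SucI order_refl)
  define w where "w i = (\<Sum>k<Suc K. v k i)" for i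
  have w1: "1 \<le> w i" if "i < n" for i
  proof -
    have "w i = v 0 i + (\<Sum>k<K. v (Suc k) i)" unfolding w_def by (rule sum.lessThan_Suc_shift)
    moreover have "0 \<le> (\<Sum>k<K. v (Suc k) i)" by (intro sum_nonneg v_nonneg that)
    ultimately show ?thesis by (simp add: v_def)
  qed
  have aw: "(\<Sum>j<n. a i j * w j) \<le> w i - 1 / 2" if "i < n" for i
  proof -
    have "(\<Sum>j<n. a i j * w j) = (\<Sum>k<Suc K. \<Sum>j<n. a i j * v k j)"
      unfolding w_def sum_distrib_left by (rule sum.swap)
    also have "\<dots> = (\<Sum>k<Suc K. v (Suc k) i)" by (simp add: v_def mat_apply_def)
    also have "\<dots> = w i - 1 + v (Suc K) i"
      using sum.lessThan_Suc_shift[of "\<lambda>k. v k i" "Suc K"]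
      unfolding w_def by (simp add: v_def)
    also have "\<dots> \<le> w i - 1 / 2" using v_le[OF that, of "Suc K"] K by linarith
    finally show ?thesis .
  qed
  define W where "W = (\<Sum>i<n. w i)"
  have wW: "w i \<le> W" if "i < n" for i
    unfolding W_def using that w1 by (intro member_le_sum) (auto intro: order_trans[OF zero_le_one])
  have W1: "1 \<le> W" using wW[OF n] w1[OF n] by linarith
  have "(\<Sum>j<n. a i j * w j) \<le> (1 - 1 / (2 * W)) * w i" if "i < n" for i
  proof -
    have "w i / (2 * W) \<le> 1 / 2" using wW[OF that] W1 by (simp add: field_simps)
    then show ?thesis using aw[OF that] by (simp add: algebra_simps)
  qed
  moreover have "0 \<le> 1 - 1 / (2 * W)" "1 - 1 / (2 * W) < 1" using W1 by (auto simp: field_simps)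
  ultimately show ?thesis using w1 by blast
qed

section \<open>Projections with small mutual interaction\<close>

lemma (in normed_space) bounded_linear_scale: "bounded_linear (scale c)"
  by (rule bounded_linear_intro[where K = "norm c"])
    (simp_all add: scale_right_distrib norm_scale mult.commute scale_of_real[symmetric] scale_left_commute)

lemma (in normed_space) bounded_operatorI:
  assumes "\<And>x y. F (x + y) = F x + F y" "\<And>c x. F (scale c x) = scale c (F x)"
    and "\<And>x. norm (F x) \<le> C * norm x"
  shows "bounded_operator scale scale F"
proof -
  have "F (r *\<^sub>R x) = r *\<^sub>R F x" for r x
    using assms(2)[of "of_real r" x] by (simp add: scale_of_real)
  then have "bounded_linear F"
    using assms(1,3) by (intro bounded_linear_intro[where K = C]) (auto simp: mult.commute)
  then show ?thesis using assms(2) by (simp add: bounded_operator_def)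
qed

text \<open>
  The inequality for \<open>w\<close> makes the cross terms \<open>Q\<^sub>i Q\<^sub>j\<close> a contraction of ratio \<open>q\<close> for the norm
  \<open>max\<^sub>i \<parallel>y\<^sub>i\<parallel> / w\<^sub>i\<close> on tuples; the normalisation \<open>w\<^sub>i \<ge> 1\<close> bounds this norm by \<open>max\<^sub>i \<parallel>y\<^sub>i\<parallel>\<close>.  This makes the system \<open>g\<^sub>i = Q\<^sub>i x - (\<Sum>j\<noteq>i. Q\<^sub>i g\<^sub>j)\<close> uniquely
  solvable in the ranges of the projections.  If \<open>x = y\<^sub>1 + \<dots> + y\<^sub>n\<close> with each \<open>y\<^sub>i\<close> in the range of
  \<open>Q\<^sub>i\<close>, applying \<open>Q\<^sub>i\<close> shows that \<open>y\<close> is the solution.  Hence the summands are determined by \<open>x\<close>,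
  and \<open>x \<mapsto> g\<^sub>1 + \<dots> + g\<^sub>n\<close> is a projection onto the sum of the ranges.
\<close>

locale almost_orthogonal_projections = normed_space scale
  for scale :: "'k::rc_field \<Rightarrow> 'a::banach \<Rightarrow> 'a" +
  fixes n :: nat and Q :: "nat \<Rightarrow> 'a \<Rightarrow> 'a" and e :: "nat \<Rightarrow> nat \<Rightarrow> real"
    and w :: "nat \<Rightarrow> real" and q :: real
  assumes Q: "\<And>i. i < n \<Longrightarrow> bounded_operator scale scale (Q i)"
    and Q_idem: "\<And>i x. i < n \<Longrightarrow> Q i (Q i x) = Q i x"
    and Q_le: "\<And>i j x. i < n \<Longrightarrow> j < n \<Longrightarrow> i \<noteq> j \<Longrightarrow> Q j x = x \<Longrightarrow> norm (Q i x) \<le> e i j * norm x"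
    and e_nonneg: "\<And>i j. i < n \<Longrightarrow> j < n \<Longrightarrow> 0 \<le> e i j"
    and q: "0 \<le> q" "q < 1"
    and w_ge_1: "\<And>i. i < n \<Longrightarrow> 1 \<le> w i"
    and w_subinvariant: "\<And>i. i < n \<Longrightarrow> (\<Sum>j<n. e i j * w j) \<le> q * w i"
begin

text \<open>For an idempotent operator this is its range.\<close>

abbreviation fixed_points :: "nat \<Rightarrow> 'a set"
  where "fixed_points i \<equiv> {x. Q i x = x}"

lemma Q_bounded_linear: "i < n \<Longrightarrow> bounded_linear (Q i)"
  using Q by (simp add: bounded_operator_def)

lemma Q_scale: "i < n \<Longrightarrow> Q i (scale c x) = scale c (Q i x)"
  using Q by (simp add: bounded_operator_def)

lemmas Q_linear = Q_bounded_linear[THEN bounded_linear.linear]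

lemma Q_add: "i < n \<Longrightarrow> Q i (x + y) = Q i x + Q i y"
  by (rule linear_add[OF Q_linear])

lemma Q_diff: "i < n \<Longrightarrow> Q i (x - y) = Q i x - Q i y"
  by (rule linear_diff[OF Q_linear])

lemma Q_neg: "i < n \<Longrightarrow> Q i (- x) = - Q i x"
  by (rule linear_neg[OF Q_linear])

lemma Q_sum: "i < n \<Longrightarrow> Q i (sum f S) = (\<Sum>x\<in>S. Q i (f x))"
  by (rule linear_sum[OF Q_linear])

definition off_diag :: "(nat \<Rightarrow> 'a) \<Rightarrow> nat \<Rightarrow> 'a"
  where "off_diag y i = (\<Sum>j\<in>{..<n} - {i}. Q i (y j))"

text \<open>
  The contraction estimate: \<open>norm (y j) \<le> c * w j\<close> for all \<open>j\<close> means that \<open>y\<close> has weighted maximum norm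
  at most \<open>c\<close>.
\<close>

lemma norm_off_diag_le:
  assumes i: "i < n" and y: "\<And>j. j < n \<Longrightarrow> y j \<in> fixed_points j" "\<And>j. j < n \<Longrightarrow> norm (y j) \<le> c * w j"
    and c: "0 \<le> c"
  shows "norm (off_diag y i) \<le> q * c * w i"
proof -
  have "norm (off_diag y i) \<le> (\<Sum>j\<in>{..<n} - {i}. norm (Q i (y j)))"
    unfolding off_diag_def by (rule norm_sum)
  also have "\<dots> \<le> (\<Sum>j\<in>{..<n} - {i}. e i j * (c * w j))"
  proof (rule sum_mono)
    fix j assume "j \<in> {..<n} - {i}"
    then have j: "j < n" "i \<noteq> j" by auto
    then have "norm (Q i (y j)) \<le> e i j * norm (y j)" using y(1) by (intro Q_le i) auto
    also have "\<dots> \<le> e i j * (c * w j)" using y(2) j i by (intro mult_left_mono e_nonneg)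
    finally show "norm (Q i (y j)) \<le> e i j * (c * w j)" .
  qed
  also have "\<dots> \<le> (\<Sum>j<n. e i j * (c * w j))"
    using i c w_ge_1 by (intro sum_mono2) (auto intro!: mult_nonneg_nonneg e_nonneg intro: order_trans[OF zero_le_one])
  also have "\<dots> = c * (\<Sum>j<n. e i j * w j)" by (simp add: sum_distrib_left mult_ac)
  also have "\<dots> \<le> c * (q * w i)" using c w_subinvariant[OF i] by (intro mult_left_mono)
  finally show ?thesis by (simp add: mult_ac)
qed

lemma off_diag_mem: "i < n \<Longrightarrow> off_diag y i \<in> fixed_points i"
  by (simp add: off_diag_def Q_sum Q_idem)

lemma off_diag_fixed_point_zero:
  assumes d: "\<And>i. i < n \<Longrightarrow> d i \<in> fixed_points i" "\<And>i. i < n \<Longrightarrow> d i = - off_diag d i" and i: "i < n"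
  shows "d i = 0"
proof -
  define c where "c = (\<Sum>i<n. norm (d i))"
  have c0: "0 \<le> c" by (simp add: c_def sum_nonneg)
  have "norm (d i) \<le> q ^ k * c * w i" if "i < n" for k i
    using that
  proof (induction k arbitrary: i)
    case 0
    have "norm (d i) \<le> c" unfolding c_def using 0 by (intro member_le_sum) auto
    also have "\<dots> \<le> c * w i" using w_ge_1[OF 0] c0 by (simp add: mult_le_cancel_left1)
    finally show ?case by simp
  next
    case (Suc k)
    have "norm (d i) = norm (off_diag d i)" using d(2)[OF Suc.prems] by (metis norm_minus_cancel)
    also have "\<dots> \<le> q * (q ^ k * c) * w i"
      using Suc c0 q(1) d(1) by (intro norm_off_diag_le) auto
    finally show ?case by (simp add: mult_ac)
  qed
  then have "\<And>k. norm (d i) \<le> q ^ k * c * w i" using i by blast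
  moreover have "(\<lambda>k. q ^ k * c * w i) \<longlonglongrightarrow> 0 * c * w i"
    using q by (intro tendsto_intros LIMSEQ_power_zero) auto
  ultimately have "norm (d i) \<le> 0 * c * w i" by (intro LIMSEQ_le_const) auto
  then show ?thesis by simp
qed

lemma Q_sum_members:
  assumes "i < n" "\<And>j. j < n \<Longrightarrow> y j \<in> fixed_points j"
  shows "Q i (\<Sum>j<n. y j) = y i + off_diag y i"
proof -
  have "Q i (\<Sum>j<n. y j) = (\<Sum>j<n. Q i (y j))" by (rule Q_sum[OF assms(1)])
  also have "\<dots> = Q i (y i) + off_diag y i"
    unfolding off_diag_def using assms(1) by (intro sum.remove) auto
  finally show ?thesis using assms by simp
qed

lemma independent: "independent_subspaces n fixed_points"
  unfolding independent_subspaces_def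
proof (intro allI impI)
  fix y i assume y: "(\<forall>i<n. y i \<in> fixed_points i) \<and> (\<Sum>i<n. y i) = 0" and i: "i < n"
  have "y j = - off_diag y j" if "j < n" for j
    using Q_sum_members[OF that, of y] y linear_0[OF Q_linear[OF that]]
    by (simp add: eq_neg_iff_add_eq_0)
  then show "y i = 0" using y i by (intro off_diag_fixed_point_zero) auto
qed

text \<open>
  The \<open>k\<close>-th term of the Neumann series that inverts \<open>y \<mapsto> y + off_diag y\<close>, applied to the tuple
  \<open>(Q\<^sub>i x)\<^sub>i\<close>.
\<close>

primrec neumann :: "nat \<Rightarrow> 'a \<Rightarrow> nat \<Rightarrow> 'a"
  where
    "neumann 0 x = (\<lambda>i. Q i x)"
  | "neumann (Suc k) x = (\<lambda>i. - off_diag (neumann k x) i)"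

lemma neumann_mem: "i < n \<Longrightarrow> neumann k x i \<in> fixed_points i"
  using off_diag_mem by (cases k) (auto simp: Q_idem Q_neg)

lemma neumann_add: "i < n \<Longrightarrow> neumann k (x + y) i = neumann k x i + neumann k y i"
  by (induction k arbitrary: i) (auto simp: Q_add off_diag_def sum.distrib)

lemma neumann_scale: "i < n \<Longrightarrow> neumann k (scale c x) i = scale c (neumann k x i)"
  by (induction k arbitrary: i) (auto simp: Q_scale off_diag_def scale_sum_right)

lemma norm_neumann_le:
  assumes "i < n"
  shows "norm (neumann k x i) \<le> q ^ k * ((\<Sum>j<n. onorm (Q j)) * norm x) * w i"
  using assms
proof (induction k arbitrary: i)
  case 0
  let ?C = "\<Sum>j<n. onorm (Q j)"
  have pos: "0 \<le> onorm (Q j)" if "j < n" for j by (rule onorm_pos_le[OF Q_bounded_linear[OF that]])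
  have "norm (Q i x) \<le> onorm (Q i) * norm x" by (rule onorm[OF Q_bounded_linear[OF 0]])
  also have "\<dots> \<le> ?C * norm x"
    using 0 pos by (intro mult_right_mono member_le_sum) auto
  also have "\<dots> \<le> ?C * norm x * w i"
    using mult_left_mono[OF w_ge_1[OF 0] mult_nonneg_nonneg[OF sum_nonneg norm_ge_zero], of "{..<n}" "\<lambda>j. onorm (Q j)" x] pos
    by simp
  finally show ?case by simp
next
  case (Suc k)
  have "norm (neumann (Suc k) x i) = norm (off_diag (neumann k x) i)" by simp
  also have "\<dots> \<le> q * (q ^ k * ((\<Sum>j<n. onorm (Q j)) * norm x)) * w i"
    using Suc q(1) neumann_mem
    by (intro norm_off_diag_le mult_nonneg_nonneg sum_nonneg onorm_pos_le Q_bounded_linear) auto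
  finally show ?case by (simp add: mult_ac)
qed

definition component :: "nat \<Rightarrow> 'a \<Rightarrow> 'a"
  where "component i x = (\<Sum>k. neumann k x i)"

lemma neumann_norm_summable:
  assumes "i < n"
  shows "summable (\<lambda>k. norm (neumann k x i))"
proof (rule summable_comparison_test'[where N = 0])
  show "summable (\<lambda>k. q ^ k * ((\<Sum>j<n. onorm (Q j)) * norm x) * w i)"
    using q by (intro summable_mult2 summable_geometric) auto
  show "norm (norm (neumann k x i)) \<le> q ^ k * ((\<Sum>j<n. onorm (Q j)) * norm x) * w i" for k
    using norm_neumann_le[OF assms] by simp
qed

lemmas neumann_summable = neumann_norm_summable[THEN summable_norm_cancel]

lemma component_add: "i < n \<Longrightarrow> component i (x + y) = component i x + component i y"
  unfolding component_def by (simp add: neumann_add suminf_add neumann_summable)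

lemma component_scale: "i < n \<Longrightarrow> component i (scale c x) = scale c (component i x)"
  unfolding component_def
  by (simp add: neumann_scale bounded_linear.suminf[OF bounded_linear_scale] neumann_summable)

lemma norm_component_le:
  assumes "i < n"
  shows "norm (component i x) \<le> (1 / (1 - q) * (\<Sum>j<n. onorm (Q j)) * w i) * norm x"
proof -
  let ?K = "(\<Sum>j<n. onorm (Q j)) * norm x"
  have s: "summable (\<lambda>k. q ^ k)" using q by (intro summable_geometric) auto
  have "norm (component i x) \<le> (\<Sum>k. norm (neumann k x i))"
    unfolding component_def by (rule summable_norm[OF neumann_norm_summable[OF assms]])
  also have "\<dots> \<le> (\<Sum>k. q ^ k * ?K * w i)"
    by (intro suminf_le norm_neumann_le assms neumann_norm_summable summable_mult2 s)
  also have "\<dots> = (\<Sum>k. q ^ k) * ?K * w i"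
    by (simp only: suminf_mult2[OF s, symmetric] suminf_mult2[OF summable_mult2[OF s], symmetric])
  also have "(\<Sum>k. q ^ k) = 1 / (1 - q)" using q by (intro suminf_geometric) auto
  finally show ?thesis by (simp add: mult_ac)
qed

lemma component_mem: "i < n \<Longrightarrow> component i x \<in> fixed_points i"
  unfolding component_def
  using neumann_mem by (simp add: bounded_linear.suminf[OF Q_bounded_linear] neumann_summable)

lemma component_eq:
  assumes "i < n"
  shows "component i x = Q i x - off_diag (\<lambda>j. component j x) i"
proof -
  have "component i x = neumann 0 x i + (\<Sum>k. neumann (Suc k) x i)"
    unfolding component_def using suminf_split_head[OF neumann_summable[OF assms]] by simp
  also have "(\<Sum>k. neumann (Suc k) x i) = - (\<Sum>k. \<Sum>j\<in>{..<n} - {i}. Q i (neumann k x j))"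
    unfolding neumann.simps off_diag_def
    using assms by (intro suminf_minus summable_sum bounded_linear.summable[OF Q_bounded_linear] neumann_summable) auto
  also have "(\<Sum>k. \<Sum>j\<in>{..<n} - {i}. Q i (neumann k x j)) = (\<Sum>j\<in>{..<n} - {i}. \<Sum>k. Q i (neumann k x j))"
    using assms by (intro suminf_sum bounded_linear.summable[OF Q_bounded_linear] neumann_summable) auto
  also have "\<dots> = off_diag (\<lambda>j. component j x) i"
    unfolding off_diag_def component_def using assms
    by (intro sum.cong refl) (simp add: bounded_linear.suminf[OF Q_bounded_linear] neumann_summable)
  finally show ?thesis by simp
qed

text \<open>
  Both the tuple of components of \<open>x = y\<^sub>1 + \<dots> + y\<^sub>n\<close> and \<open>y\<close> itself solve the same affine system,
  so their difference is a fixed point of \<open>- off_diag\<close>.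
\<close>

lemma component_sum:
  assumes "\<And>j. j < n \<Longrightarrow> y j \<in> fixed_points j" and i: "i < n"
  shows "component i (\<Sum>j<n. y j) = y i"
proof -
  define d where "d i = component i (\<Sum>j<n. y j) - y i" for i
  have "d i = 0"
  proof (rule off_diag_fixed_point_zero)
    show "d j \<in> fixed_points j" if "j < n" for j
      using component_mem[OF that] assms(1)[OF that] by (simp add: d_def Q_diff that)
    show "d j = - off_diag d j" if "j < n" for j
    proof -
      have "d j = off_diag y j - off_diag (\<lambda>l. component l (\<Sum>j<n. y j)) j"
        unfolding d_def using component_eq[OF that] Q_sum_members[OF that assms(1)]
        by (simp add: algebra_simps)
      also have "\<dots> = - off_diag d j"
        using that by (simp add: d_def off_diag_def Q_diff sum_subtractf)
      finally show ?thesis .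
    qed
  qed (rule i)
  then show ?thesis by (simp add: d_def)
qed

lemma complemented_sum: "complemented scale (sum_subspaces n fixed_points)"
proof -
  define P where "P x = (\<Sum>i<n. component i x)" for x
  have "bounded_operator scale scale P"
  proof (rule bounded_operatorI)
    show "P (x + y) = P x + P y" for x y
      by (simp add: P_def component_add sum.distrib)
    show "P (scale c x) = scale c (P x)" for c x
      by (simp add: P_def component_scale scale_sum_right)
    show "norm (P x) \<le> (\<Sum>i<n. 1 / (1 - q) * (\<Sum>j<n. onorm (Q j)) * w i) * norm x" for x
      unfolding P_def sum_distrib_right
      by (rule order_trans[OF norm_sum sum_mono]) (use norm_component_le in simp)
  qed
  moreover have mem: "P x \<in> sum_subspaces n fixed_points" for x
    unfolding P_def sum_subspaces_def using component_mem by blast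
  moreover have fixed: "P x = x" if x: "x \<in> sum_subspaces n fixed_points" for x
  proof -
    obtain y where "\<And>i. i < n \<Longrightarrow> y i \<in> fixed_points i" "x = (\<Sum>i<n. y i)"
      using x by (auto simp: sum_subspaces_def)
    then show ?thesis by (simp add: P_def component_sum)
  qed
  moreover have "range P = sum_subspaces n fixed_points"
  proof (intro equalityI subsetI)
    show "x \<in> sum_subspaces n fixed_points" if "x \<in> range P" for x using that mem by blast
    show "x \<in> range P" if "x \<in> sum_subspaces n fixed_points" for x using fixed[OF that] by (metis rangeI)
  qed
  ultimately show ?thesis unfolding complemented_def by blast
qed

end

section \<open>Extension of bounded operators to the completion\<close>

lemma closed_eq_set:
  assumes "bounded_linear F" "bounded_linear G"
  shows "closed {x. F x = G x}"
  using assms by (intro closed_Collect_eq linear_continuous_on)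

text \<open>
  The bound on \<open>T\<close> makes \<open>\<iota> (T u)\<close> depend on \<open>\<iota> u\<close> only, in a Lipschitz way.  The induced map on the
  dense subspace \<open>\<iota> ` V\<close> therefore has a continuous extension, and linearity and the bound survive
  because they are closed conditions.
\<close>

lemma dense_bounded_operator_extension:
  fixes t :: "'k::rc_field \<Rightarrow> 'c::banach \<Rightarrow> 'c" and V :: "'v::ab_group_add set"
  assumes "normed_space t" and s: "vector_space s" "Modules.module.subspace s V"
    and \<iota>_add: "\<And>u v. u \<in> V \<Longrightarrow> v \<in> V \<Longrightarrow> \<iota> (u + v) = \<iota> u + \<iota> v"
    and \<iota>_scale: "\<And>c u. u \<in> V \<Longrightarrow> \<iota> (s c u) = t c (\<iota> u)"
    and dense: "closure (\<iota> ` V) = (UNIV :: 'c set)"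
    and T_in: "\<And>u. u \<in> V \<Longrightarrow> T u \<in> V"
    and T_add: "\<And>u v. u \<in> V \<Longrightarrow> v \<in> V \<Longrightarrow> T (u + v) = T u + T v"
    and T_scale: "\<And>c u. u \<in> V \<Longrightarrow> T (s c u) = s c (T u)"
    and T_le: "\<And>u. u \<in> V \<Longrightarrow> norm (\<iota> (T u)) \<le> C * norm (\<iota> u)"
  obtains F where "bounded_operator t t F" "\<And>u. u \<in> V \<Longrightarrow> F (\<iota> u) = \<iota> (T u)"
proof -
  interpret S: vector_space s by fact
  interpret N: normed_space t by fact
  define D where "D = \<iota> ` V"
  \<comment> \<open>the induced map on the dense subspace, through an arbitrary choice of preimages\<close>
  define f where "f x = \<iota> (T (SOME u. u \<in> V \<and> \<iota> u = x))" for x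
  have minus: "- u \<in> V \<and> \<iota> (- u) = - \<iota> u" if "u \<in> V" for u
    using S.subspace_neg[OF s(2) that] \<iota>_scale[OF that, of "- 1"] by simp
  have diff: "\<iota> (u - v) = \<iota> u - \<iota> v" if "u \<in> V" "v \<in> V" for u v
    using \<iota>_add[OF that(1), of "- v"] minus[OF that(2)] by simp
  have T_diff: "T (u - v) = T u - T v" if "u \<in> V" "v \<in> V" for u v
    using T_add[OF that(1), of "- v"] minus[OF that(2)] T_scale[OF that(2), of "- 1"] by simp
  have T_dist: "norm (\<iota> (T u) - \<iota> (T v)) \<le> C * norm (\<iota> u - \<iota> v)" if "u \<in> V" "v \<in> V" for u v
    using T_le[OF S.subspace_diff[OF s(2) that]] that T_in by (simp add: T_diff diff)
  have f_\<iota>: "f (\<iota> u) = \<iota> (T u)" if u: "u \<in> V" for u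
  proof -
    let ?v = "SOME v. v \<in> V \<and> \<iota> v = \<iota> u"
    have v: "?v \<in> V \<and> \<iota> ?v = \<iota> u" using u by (rule_tac someI[of _ u]) simp
    then have "norm (\<iota> (T ?v) - \<iota> (T u)) \<le> C * 0" using T_dist[of ?v u] u by simp
    then show ?thesis by (simp add: f_def)
  qed
  have lip: "norm (f x - f y) \<le> \<bar>C\<bar> * norm (x - y)" if "x \<in> D" "y \<in> D" for x y
  proof -
    obtain u v where "u \<in> V" "x = \<iota> u" "v \<in> V" "y = \<iota> v" using \<open>x \<in> D\<close> \<open>y \<in> D\<close> by (auto simp: D_def)
    then have "norm (f x - f y) \<le> C * norm (x - y)" by (simp add: f_\<iota> T_dist)
    also have "\<dots> \<le> \<bar>C\<bar> * norm (x - y)" by (intro mult_right_mono) auto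
    finally show ?thesis .
  qed
  then have "\<bar>C\<bar>-lipschitz_on D f" by (intro lipschitz_onI) (auto simp: dist_norm)
  then have "uniformly_continuous_on D f" by (rule lipschitz_on_uniformly_continuous)
  then obtain F where F: "uniformly_continuous_on (closure D) F" "\<And>x. x \<in> D \<Longrightarrow> f x = F x"
    using uniformly_continuous_on_extension_on_closure by metis
  have cont: "continuous_on UNIV F"
    using uniformly_continuous_imp_continuous[OF F(1)] dense by (simp add: D_def)
  have F_\<iota>: "F (\<iota> u) = \<iota> (T u)" if "u \<in> V" for u
    using F(2)[of "\<iota> u"] f_\<iota>[OF that] that by (simp add: D_def)
  note cont_comp = continuous_on_compose2[OF cont]
  have scale_cont: "continuous_on A (t c)" for A c
    by (rule linear_continuous_on[OF N.bounded_linear_scale])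
  have add: "F (x + y) = F x + F y" for x y
  proof -
    have D: "F (x + y) = F x + F y" if "x \<in> D" "y \<in> D" for x y
    proof -
      obtain u v where uv: "u \<in> V" "x = \<iota> u" "v \<in> V" "y = \<iota> v"
        using \<open>x \<in> D\<close> \<open>y \<in> D\<close> by (auto simp: D_def)
      have "F (\<iota> (u + v)) = \<iota> (T (u + v))" by (intro F_\<iota> S.subspace_add[OF s(2)] uv)
      then show ?thesis using uv T_in by (simp add: \<iota>_add T_add F_\<iota>)
    qed
    have "closure (D \<times> D) \<subseteq> {z. F (fst z + snd z) = F (fst z) + F (snd z)}"
      by (intro closure_minimal closed_Collect_eq continuous_intros cont_comp) (auto simp: D)
    moreover have "(x, y) \<in> closure (D \<times> D)" using dense by (simp add: closure_Times D_def)
    ultimately show ?thesis by auto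
  qed
  have scale: "F (t c x) = t c (F x)" for c x
  proof -
    have "closure D \<subseteq> {x. F (t c x) = t c (F x)}"
    proof (intro closure_minimal closed_Collect_eq)
      show "D \<subseteq> {x. F (t c x) = t c (F x)}"
      proof clarsimp
        fix x assume "x \<in> D"
        then obtain u where u: "u \<in> V" "x = \<iota> u" by (auto simp: D_def)
        have "F (\<iota> (s c u)) = \<iota> (T (s c u))" by (intro F_\<iota> S.subspace_scale[OF s(2)] u)
        then show "F (t c x) = t c (F x)" using u T_in by (simp add: \<iota>_scale T_scale F_\<iota>)
      qed
      show "continuous_on UNIV (\<lambda>x. F (t c x))" "continuous_on UNIV (\<lambda>x. t c (F x))"
        by (rule cont_comp[OF scale_cont], simp)
          (rule continuous_on_compose2[OF scale_cont cont subset_UNIV])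
    qed
    then show ?thesis using dense by (auto simp: D_def)
  qed
  have le: "norm (F x) \<le> norm x * C" for x
  proof -
    have "closure D \<subseteq> {x. norm (F x) \<le> norm x * C}"
      by (intro closure_minimal closed_Collect_le continuous_intros cont)
        (use T_le F_\<iota> in \<open>auto simp: D_def mult.commute\<close>)
    then show ?thesis using dense by (auto simp: D_def)
  qed
  have "bounded_linear F"
  proof (rule bounded_linear_intro[OF add _ le])
    show "F (r *\<^sub>R x) = r *\<^sub>R F x" for r x
      using scale[of "of_real r" x] by (simp add: N.scale_of_real)
  qed
  then have "bounded_operator t t F" using scale by (simp add: bounded_operator_def)
  then show thesis using that F_\<iota> by blast
qed

section \<open>Tensor products of operators\<close>

lemma subspace_tensor_power: "tensor.subspace (tensor_power s Y)"
  unfolding tensor_power_def by (rule tensor.subspace_span)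

lemma elem_tensor_in_tensor_power: "(\<And>i. x i \<in> Y) \<Longrightarrow> elem_tensor s x \<in> tensor_power s Y"
  unfolding tensor_power_def by (rule tensor.span_base) blast

lemma tensor_power_induct [consumes 1, case_names zero step]:
  assumes "u \<in> tensor_power s Y" and "P 0"
    and "\<And>c x u. (\<And>i. x i \<in> Y) \<Longrightarrow> P u \<Longrightarrow> P (tensor_scale c (elem_tensor s x) + u)"
  shows "P u"
  using assms(1) unfolding tensor_power_def
proof (induction rule: tensor.span_induct_alt)
  case base
  show ?case by (rule assms(2))
next
  case (step c v u)
  then obtain x where "v = elem_tensor s x" "\<And>i. x i \<in> Y" by blast
  then show ?case using assms(3) step.IH by blast
qed

lemma tensor_op_zero: "tensor_op s A 0 = 0"
  by (auto simp: tensor_op_def fun_eq_iff)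

lemma bounded_operator_add: "bounded_operator s t A \<Longrightarrow> A (x + y) = A x + A y"
  by (simp add: bounded_operator_def linear_simps)

lemma bounded_operator_scale: "bounded_operator s t A \<Longrightarrow> A (s c x) = t c (A x)"
  by (simp add: bounded_operator_def)

lemma tensor_op_elem_tensor_bounded:
  assumes "\<And>i. bounded_operator s s (A i)"
  shows "tensor_op s A (elem_tensor s x) = elem_tensor s (\<lambda>i. A i (x i))"
  by (rule tensor_op_elem_tensor)
    (rule bounded_operator_add[OF assms] bounded_operator_scale[OF assms])+

lemma tensor_op_in_tensor_power:
  assumes A: "\<And>i. bounded_operator s s (A i)" "\<And>i x. x \<in> Y \<Longrightarrow> A i x \<in> Z"
    and u: "u \<in> tensor_power s Y"
  shows "tensor_op s A u \<in> tensor_power s Z"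
  using u
proof (induction rule: tensor_power_induct)
  case zero
  show ?case unfolding tensor_op_zero by (rule tensor.subspace_0[OF subspace_tensor_power])
next
  case (step c x u)
  then show ?case
    unfolding tensor_op_linear tensor_op_elem_tensor_bounded[OF A(1)]
    by (intro tensor.subspace_add[OF subspace_tensor_power] tensor.subspace_scale[OF subspace_tensor_power]
        elem_tensor_in_tensor_power A(2))
qed

lemma tensor_op_cong:
  assumes A: "\<And>i. bounded_operator s s (A i)" and B: "\<And>i. bounded_operator s s (B i)"
    and eq: "\<And>i x. x \<in> Y \<Longrightarrow> A i x = B i x"
    and u: "u \<in> tensor_power s Y"
  shows "tensor_op s A u = tensor_op s B u"
  using u
proof (induction rule: tensor_power_induct)
  case zero
  show ?case by (simp only: tensor_op_zero)
next
  case (step c x u)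
  then show ?case
    unfolding tensor_op_linear tensor_op_elem_tensor_bounded[OF A] tensor_op_elem_tensor_bounded[OF B]
    by (simp only: eq)
qed

lemma tensor_op_id_on:
  assumes A: "\<And>i. bounded_operator s s (A i)" and eq: "\<And>i x. x \<in> Y \<Longrightarrow> A i x = x"
    and u: "u \<in> tensor_power s Y"
  shows "tensor_op s A u = u"
  using u
proof (induction rule: tensor_power_induct)
  case zero
  show ?case by (simp only: tensor_op_zero)
next
  case (step c x u)
  then show ?case
    unfolding tensor_op_linear tensor_op_elem_tensor_bounded[OF A]
    by (simp only: eq)
qed

text \<open>
  The operator norm is a real supremum of quotients, and bounds each of them because the boundedness
  part of the property bounds the set of quotients from above.
\<close>

lemma property_P2_le:
  fixes A :: "'m::finite \<Rightarrow> 'a::real_normed_vector \<Rightarrow> 'a" and s :: "'k::rc_field \<Rightarrow> 'a \<Rightarrow> 'a"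
  assumes N: "norm_on tensor_scale (tensor_power s UNIV) \<alpha>" and P2: "property_P2 s \<alpha>"
    and A: "\<And>i. bounded_operator s s (A i)" and u: "u \<in> tensor_power s UNIV"
  shows "\<alpha> (tensor_op s A u) \<le> (\<Prod>i\<in>UNIV. onorm (A i)) * \<alpha> u"
proof -
  let ?V = "tensor_power s UNIV :: ('k, 'a, 'm) tensor set"
  have pos: "0 \<le> \<alpha> v" and eq0: "\<alpha> v = 0 \<longleftrightarrow> v = 0" if "v \<in> ?V" for v
    using N that by (auto simp: norm_on_def)
  obtain C where C: "\<And>v. v \<in> ?V \<Longrightarrow> \<alpha> (tensor_op s A v) \<le> C * \<alpha> v"
    using P2 A unfolding property_P2_def bounded_on_def by blast
  have "\<alpha> (tensor_op s A v) / \<alpha> v \<le> \<bar>C\<bar>" if "v \<in> ?V" for v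
  proof (cases "\<alpha> v = 0")
    case False
    then have "0 < \<alpha> v" using pos[OF that] by simp
    then have "\<alpha> (tensor_op s A v) / \<alpha> v \<le> C" using C[OF that] by (simp add: divide_le_eq)
    then show ?thesis by simp
  qed simp
  then have "bdd_above ((\<lambda>v. \<alpha> (tensor_op s A v) / \<alpha> v) ` ?V)"
    by (intro bdd_aboveI[of _ "\<bar>C\<bar>"]) auto
  then have "\<alpha> (tensor_op s A u) / \<alpha> u \<le> operator_norm_on ?V \<alpha> (tensor_op s A)"
    unfolding operator_norm_on_def using u by (intro cSUP_upper)
  also have "\<dots> = (\<Prod>i\<in>UNIV. onorm (A i))"
    using P2 A unfolding property_P2_def by blast
  finally have le: "\<alpha> (tensor_op s A u) / \<alpha> u \<le> (\<Prod>i\<in>UNIV. onorm (A i))" .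
  show ?thesis
  proof (cases "u = 0")
    case True
    then show ?thesis using eq0[OF u] by (simp add: tensor_op_zero)
  next
    case False
    then have "0 < \<alpha> u" using pos[OF u] eq0[OF u] by simp
    then show ?thesis using le by (simp add: divide_le_eq)
  qed
qed

section \<open>Tensor powers of projections on the completion\<close>

locale tensor_completion = N: normed_space t
  for t :: "'k::rc_field \<Rightarrow> 'c::banach \<Rightarrow> 'c" +
  fixes s :: "'k \<Rightarrow> 'a::banach \<Rightarrow> 'a" and \<alpha> :: "('k, 'a, 'm::finite) tensor \<Rightarrow> real"
    and \<iota> :: "('k, 'a, 'm) tensor \<Rightarrow> 'c"
  assumes norm_on: "norm_on tensor_scale (tensor_power s UNIV) \<alpha>"
    and P2: "property_P2 s \<alpha>"
    and completion: "completion_of tensor_scale (tensor_power s UNIV) \<alpha> t \<iota>"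
begin

lemma norm_\<iota>_eq: "u \<in> tensor_power s UNIV \<Longrightarrow> norm (\<iota> u) = \<alpha> u"
  and dense: "closure (\<iota> ` tensor_power s UNIV) = UNIV"
  using completion by (auto simp: completion_of_def)

lemma tensor_power_subset: "tensor_power s Y \<subseteq> tensor_power s UNIV"
  unfolding tensor_power_def by (rule tensor.span_mono) auto

lemma norm_\<iota>_tensor_op_le:
  assumes "\<And>i. bounded_operator s s (A i)" "u \<in> tensor_power s UNIV"
  shows "norm (\<iota> (tensor_op s A u)) \<le> (\<Prod>i\<in>UNIV. onorm (A i)) * norm (\<iota> u)"
  using property_P2_le[OF norm_on P2 assms] assms tensor_op_in_tensor_power[OF assms(1) _ assms(2)]
  by (simp add: norm_\<iota>_eq)

lemma tensor_op_extension:
  assumes A: "\<And>i. bounded_operator s s (A i)"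
  obtains F where "bounded_operator t t F"
    "\<And>u. u \<in> tensor_power s UNIV \<Longrightarrow> F (\<iota> u) = \<iota> (tensor_op s A u)"
proof (rule dense_bounded_operator_extension[where T = "tensor_op s A" and V = "tensor_power s UNIV"
      and s = tensor_scale and t = t and \<iota> = \<iota>])
  show "tensor_op s A u \<in> tensor_power s UNIV" if "u \<in> tensor_power s UNIV" for u
    using A _ that by (rule tensor_op_in_tensor_power) simp
  show "norm (\<iota> (tensor_op s A u)) \<le> (\<Prod>i\<in>UNIV. onorm (A i)) * norm (\<iota> u)"
    if "u \<in> tensor_power s UNIV" for u
    using A that by (rule norm_\<iota>_tensor_op_le)
qed (use completion that in \<open>auto simp: completion_of_def tensor_op_linear subspace_tensor_power
      intro: N.normed_space_axioms tensor.vector_space_axioms\<close>)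

text \<open>
  The tensor power of a projection onto \<open>Y\<close> maps the tensor power of the whole space into that of \<open>Y\<close>
  and fixes the latter pointwise; both facts pass to closures.
\<close>

lemma tensor_projection:
  assumes P: "bounded_operator s s P" "\<And>x. P x \<in> Y" "\<And>y. y \<in> Y \<Longrightarrow> P y = y"
    and F: "bounded_operator t t F"
      "\<And>u. u \<in> tensor_power s UNIV \<Longrightarrow> F (\<iota> u) = \<iota> (tensor_op s (\<lambda>_. P) u)"
  shows "F x \<in> closed_tensor_power s \<iota> Y" "x \<in> closed_tensor_power s \<iota> Y \<Longrightarrow> F x = x"
proof -
  have lin: "bounded_linear F" using F(1) by (simp add: bounded_operator_def)
  have "F ` closure (\<iota> ` tensor_power s UNIV) \<subseteq> closed_tensor_power s \<iota> Y"
  proof (rule image_closure_subset)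
    show "continuous_on (closure (\<iota> ` tensor_power s UNIV)) F"
      by (rule linear_continuous_on[OF lin])
    show "closed (closed_tensor_power s \<iota> Y)" by (simp add: closed_tensor_power_def)
    have "F (\<iota> u) \<in> \<iota> ` tensor_power s Y" if "u \<in> tensor_power s UNIV" for u
      using F(2)[OF that] tensor_op_in_tensor_power[OF P(1) P(2) that] by simp
    then show "F ` \<iota> ` tensor_power s UNIV \<subseteq> closed_tensor_power s \<iota> Y"
      unfolding closed_tensor_power_def using closure_subset by blast
  qed
  then show "F x \<in> closed_tensor_power s \<iota> Y" by (auto simp: dense)
  have "F (\<iota> u) = \<iota> u" if "u \<in> tensor_power s Y" for u
    using F(2)[of u] tensor_power_subset that tensor_op_id_on[OF P(1) P(3) that] by auto
  then have "closed_tensor_power s \<iota> Y \<subseteq> {x. F x = x}"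
    unfolding closed_tensor_power_def
    by (intro closure_minimal closed_eq_set lin bounded_linear_ident) auto
  then show "x \<in> closed_tensor_power s \<iota> Y \<Longrightarrow> F x = x" by blast
qed

text \<open>
  On tensors over \<open>Y\<close> the operator \<open>P\<close> may be replaced by \<open>P \<circ> R\<close> in every factor.  This is what turns
  the small norm of \<open>P \<circ> R\<close> into its \<open>m\<close>-th power.
\<close>

lemma norm_tensor_projection_le:
  fixes Y :: "'a set"
  assumes P: "bounded_operator s s P" and R: "bounded_operator s s R" "\<And>y. y \<in> Y \<Longrightarrow> R y = y"
    and F: "bounded_operator t t F"
      "\<And>u. u \<in> tensor_power s UNIV \<Longrightarrow> F (\<iota> u) = \<iota> (tensor_op s (\<lambda>_. P) u)"
    and x: "x \<in> closed_tensor_power s \<iota> Y"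
  shows "norm (F x) \<le> onorm (P \<circ> R) ^ CARD('m) * norm x"
proof -
  have lin: "bounded_linear F" using F(1) by (simp add: bounded_operator_def)
  have PR: "bounded_operator s s (P \<circ> R)"
    using P R(1) by (auto simp: bounded_operator_def o_def intro: bounded_linear_compose)
  have "norm (F (\<iota> u)) \<le> onorm (P \<circ> R) ^ CARD('m) * norm (\<iota> u)" if u: "u \<in> tensor_power s Y" for u
  proof -
    have u': "u \<in> tensor_power s UNIV" using u tensor_power_subset by blast
    have "tensor_op s (\<lambda>_. P) u = tensor_op s (\<lambda>_. P \<circ> R) u"
      using P PR _ u by (rule tensor_op_cong) (simp add: R(2))
    then show ?thesis using F(2)[OF u'] norm_\<iota>_tensor_op_le[OF PR u'] by simp
  qed
  then have "closed_tensor_power s \<iota> Y \<subseteq> {x. norm (F x) \<le> onorm (P \<circ> R) ^ CARD('m) * norm x}"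
    unfolding closed_tensor_power_def
    by (intro closure_minimal closed_Collect_le continuous_intros linear_continuous_on lin) auto
  then show ?thesis using x by blast
qed

end

section \<open>Independence and complementation of closed tensor powers\<close>

theorem theorem4p2:
  fixes scale :: "'k::rc_field \<Rightarrow> 'a::banach \<Rightarrow> 'a"
    and ip :: "'a \<Rightarrow> 'a \<Rightarrow> 'k"
    and n :: nat
    and X :: "nat \<Rightarrow> 'a set"
    and \<alpha> :: "('k, 'a, 'm::finite) tensor \<Rightarrow> real"
    and scaleC :: "'k \<Rightarrow> 'c::banach \<Rightarrow> 'c"
    and \<iota> :: "('k, 'a, 'm) tensor \<Rightarrow> 'c"
  assumes "hilbert_space scale ip"
    and "n \<ge> 1"
    and "\<And>i. i < n \<Longrightarrow> Modules.module.subspace scale (X i)"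
    and "\<And>i. i < n \<Longrightarrow> closed (X i)"
    and "norm_on tensor_scale (tensor_power scale UNIV) \<alpha>"
    and "property_P2 scale \<alpha>"
    and "completion_of tensor_scale (tensor_power scale UNIV) \<alpha> scaleC \<iota>"
    and "spectral_radius (angle_matrix ip CARD('m) n X) < 1"
  shows "independent_subspaces n (\<lambda>i. closed_tensor_power scale \<iota> (X i)) \<and>
    complemented scaleC (sum_subspaces n (\<lambda>i. closed_tensor_power scale \<iota> (X i)))"
proof -
  interpret H: hilbert_space scale ip by fact
  interpret tensor_completion scaleC scale \<alpha> \<iota>
    using assms(5-7)
    by (simp add: tensor_completion_def tensor_completion_axioms_def completion_of_def)
  note X = assms(3,4)
  let ?m = "CARD('m)"
  let ?Y = "\<lambda>i. closed_tensor_power scale \<iota> (X i)"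
  define orth where "orth i P \<longleftrightarrow> bounded_operator scale scale P \<and> (\<forall>x. P x \<in> X i) \<and>
      (\<forall>y\<in>X i. P y = y) \<and> (\<forall>x. \<forall>y\<in>X i. ip (x - P x) y = 0) \<and> (\<forall>x. norm (P x) \<le> norm x)" for i P
  have "\<exists>P. orth i P" if "i < n" for i
    by (rule H.orthogonal_projection_exists[OF X[OF that]]) (auto simp: orth_def)
  then obtain P where "\<And>i. i < n \<Longrightarrow> orth i (P i)" by metis
  then have P: "\<And>i. i < n \<Longrightarrow> bounded_operator scale scale (P i)"
      "\<And>i x. i < n \<Longrightarrow> P i x \<in> X i" "\<And>i y. i < n \<Longrightarrow> y \<in> X i \<Longrightarrow> P i y = y"
      "\<And>i x y. i < n \<Longrightarrow> y \<in> X i \<Longrightarrow> ip (x - P i x) y = 0"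
      "\<And>i x. i < n \<Longrightarrow> norm (P i x) \<le> norm x"
    unfolding orth_def by blast+
  have "\<exists>F. bounded_operator scaleC scaleC F \<and>
      (\<forall>u\<in>tensor_power scale UNIV. F (\<iota> u) = \<iota> (tensor_op scale (\<lambda>_. P i) u))" if "i < n" for i
    using tensor_op_extension[of "\<lambda>_. P i"] P(1)[OF that] by metis
  then obtain Q where Q: "\<And>i. i < n \<Longrightarrow> bounded_operator scaleC scaleC (Q i)"
      "\<And>i u. i < n \<Longrightarrow> u \<in> tensor_power scale UNIV \<Longrightarrow> Q i (\<iota> u) = \<iota> (tensor_op scale (\<lambda>_. P i) u)"
    by metis
  have Q_mem: "Q i x \<in> ?Y i" and Q_id: "x \<in> ?Y i \<Longrightarrow> Q i x = x" if "i < n" for i x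
    using tensor_projection[OF P(1-3)[OF that] Q[OF that]] that by blast+
  have fixed: "{x. Q i x = x} = ?Y i" if "i < n" for i
    using Q_mem[OF that] Q_id[OF that] by (metis (mono_tags, lifting) Collect_cong Collect_mem_eq)
  define e where "e i j = (if i = j then 0 else min_angle_cos ip (X i) (X j) ^ ?m)" for i j
  have e_nonneg: "0 \<le> e i j" if "i < n" "j < n" for i j
    using H.min_angle_cos_nonneg[OF X(1) X(1)] that by (simp add: e_def)
  have Q_le: "norm (Q i x) \<le> e i j * norm x" if ij: "i < n" "j < n" "i \<noteq> j" and x: "Q j x = x" for i j x
  proof -
    have "x \<in> ?Y j" using Q_mem[OF ij(2), of x] x by simp
    then have "norm (Q i x) \<le> onorm (P i \<circ> P j) ^ ?m * norm x"
      by (intro norm_tensor_projection_le[OF P(1)[OF ij(1)] P(1)[OF ij(2)] P(3)[OF ij(2)] Q[OF ij(1)]]) auto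
    also have "\<dots> \<le> min_angle_cos ip (X i) (X j) ^ ?m * norm x"
    proof (intro mult_right_mono power_mono norm_ge_zero)
      show "onorm (P i \<circ> P j) \<le> min_angle_cos ip (X i) (X j)"
        using ij X(1) P by (intro H.onorm_comp_projections_le_min_angle_cos) auto
      show "0 \<le> onorm (P i \<circ> P j)"
        using P(1) ij unfolding o_def
        by (intro onorm_pos_le bounded_linear_compose[of "P i" "P j"]) (auto simp: bounded_operator_def)
    qed
    finally show ?thesis using ij(3) by (simp add: e_def)
  qed
  have "angle_matrix ip ?m n X = complex_mat n e"
    by (auto simp: angle_matrix_def e_def intro!: eq_matI)
  then have sr: "spectral_radius (complex_mat n e) < 1" using assms(8) by simp
  have n: "n > 0" using assms(2) by simp
  obtain q w where wq: "0 \<le> q" "q < 1"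
      "\<forall>i<n. 1 \<le> w i \<and> (\<Sum>j<n. e i j * w j) \<le> q * w i"
    using subinvariant_weight_exists[OF n e_nonneg sr] by blast
  interpret almost_orthogonal_projections scaleC n Q e w q
    by unfold_locales (use Q(1) Q_mem Q_id Q_le e_nonneg wq in auto)
  have "independent_subspaces n ?Y"
    using independent by (simp add: independent_subspaces_def fixed[symmetric])
  moreover have "sum_subspaces n fixed_points = sum_subspaces n ?Y"
    by (simp add: sum_subspaces_def fixed[symmetric])
  ultimately show ?thesis using complemented_sum by simp
qed

end
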